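(* The universal object $p:\widetilde{\mathbb{T}}\to\mathbb{T}$ in the category of fibrations with unique path lifting and path-connected total space over $\mathbb{T}$ is not a path component of any inverse limit of covering projections over $\mathbb{T}$. That is, if $u:Y\to\mathbb{T}$ is an inverse limit of covering projections over $\mathbb{T}$ and $Y_0$ is a path component of $Y$, then there is no homeomorphism $\varphi:\widetilde{\mathbb{T}}\to Y_0$ with $u\circ\varphi=p$.
   Context: For each $m\in\mathbb{N}=\{1,2,3,\dots\}$ let $C_m\subseteq\mathbb{R}^2$ be the circle of radius $\frac1m$ centered at $(\frac1m,0)$; let $\mathbb{E}=\bigcup_{m\in\mathbb{N}}C_m\subseteq\mathbb{R}^2$ (subspace topology) with basepoint $\ast=(0,0)$. Let $\ell_m:[0,1]\to C_m$ be the loop $\ell_m(t)=\left(\frac1m(1-\cos 2\pi t),\frac1m\sin 2\pi t\right)$. Let $f:\mathbb{E}\to\mathbb{E}$ be the unique continuous map with $f\circ\ell_m=\ell_{m+1}$ for all $m\in\mathbb{N}$. Let $\mathbb{T}$ be the mapping torus of $f$, i.e. the quotient space $\mathbb{E}\times[0,1]/\sim$ with $(x,1)\sim(f(x),0)$ for all $x\in\mathbb{E}$, and let $h:\mathbb{E}\times[0,1]\to\mathbb{T}$ be the quotient map. The basepoint of $\mathbb{T}$ is $\ast=h(\ast,0)$. "Fibration" means Hurewicz fibration. A map $p:Y\to X$ has unique path lifting if any two paths $\omega,\omega'$ in $Y$ with $\omega(0)=\omega'(0)$ and $p\circ\omega=p\circ\omega'$ are equal. In the category of (pointed) fibrations with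 unique path lifting and path-connected total space over $(X,x)$, a morphism from $p:(Y,y)\to(X,x)$ to $p':(Y',y')\to(X,x)$ is a continuous map $g:(Y,y)\to(Y',y')$ with $p'\circ g=p$. The universal object is an object $p:(\widetilde{X},\widetilde{x})\to(X,x)$ of this category admitting a morphism to every object; it exists for every path-connected $X$ (as shown in Spanier's textbook Algebraic Topology: choose an indexed set $\{r_a:(Z_a,z_a)\to(X,x)\mid a\in A\}$ containing one representative of each isomorphism class of objects of this category, let $\widetilde{X}$ be the path component of the point $\widetilde{x}=(z_a)_{a\in A}$ in the fibered product $\{(w_a)_{a\in A}\in\prod_{a\in A}Z_a\mid r_a(w_a)=r_b(w_b)\text{ for all }a,b\in A\}$, and put $p((w_a)_{a\in A})=r_a(w_a)$ for any $a\in A$) and is unique up to isomorphism. An inverse limit of covering projections over $\mathbb{T}$ is formed as follows: $(\Lambda,\leqslant)$ is a (nonempty) directed set; for each $i\in\Lambda$, $p_i:Y_i\to\mathbb{T}$ is a covering projection; for $i\leqslant j$, $f_{i,j}:Y_j\to Y_i$ is a continuous map with $p_i\circ f_{i,j}=p_j$, and $f_{i,j}\circ f_{j,k}=f_{i,k}$ whenever $i\leqslant j\leqslant k$, with $f_{i,i}=\mathrm{id}$. Then $Y=\{(y_i)_{i\in\Lambda}\in\prod_{i\in\Lambda}Y_i\mid f_{i,j}(y_j)=y_i\text{ for all }i\leqslant j\}$ with the subspace topology of the product, and $u((y_i)_{i\in\Lambda})=p_i(y_i)$ for any $i\in\Lambda$. *)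

theory Defs
  imports "HOL-Analysis.Analysis"
begin

section \<open>The Hawaiian earring\<close>

definition earring_circle :: "nat \<Rightarrow> (real \<times> real) set" where
  "earring_circle m = sphere (1 / real m, 0) (1 / real m)"

definition hawaiian_earring :: "(real \<times> real) topology" where
  "hawaiian_earring = top_of_set (\<Union>m\<in>{1..}. earring_circle m)"

definition earring_loop :: "nat \<Rightarrow> real \<Rightarrow> real \<times> real" where
  "earring_loop m t =
     (1 / real m * (1 - cos (2 * pi * t)), 1 / real m * sin (2 * pi * t))"

definition is_earring_shift :: "(real \<times> real \<Rightarrow> real \<times> real) \<Rightarrow> bool" where
  "is_earring_shift f \<longleftrightarrow>
     continuous_map hawaiian_earring hawaiian_earring f \<and>
     (\<forall>m\<ge>1. \<forall>t\<in>{0..1}. f (earring_loop m t) = earring_loop (Suc m) t)"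


section \<open>Mapping tori\<close>

definition quotient_topology :: "'a topology \<Rightarrow> ('a \<Rightarrow> 'b) \<Rightarrow> 'b topology" where
  "quotient_topology X q =
     topology (\<lambda>U. U \<subseteq> q ` topspace X \<and> openin X {x \<in> topspace X. q x \<in> U})"

abbreviation unit_interval :: "real topology" where
  "unit_interval \<equiv> top_of_set {0..1}"

inductive mapping_torus_glue :: "'a topology \<Rightarrow> ('a \<Rightarrow> 'a) \<Rightarrow> 'a \<times> real \<Rightarrow> 'a \<times> real \<Rightarrow> bool"
  for X f where
  "x \<in> topspace X \<Longrightarrow> mapping_torus_glue X f (x, 1) (f x, 0)"

text \<open>Points of the mapping torus are the classes of the equivalence relation
  on \<open>X \<times> [0,1]\<close> generated by the gluing.\<close>

definition mapping_torus_proj :: "'a topology \<Rightarrow> ('a \<Rightarrow> 'a) \<Rightarrow> 'a \<times> real \<Rightarrow> ('a \<times> real) set" where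
  "mapping_torus_proj X f a =
     {b \<in> topspace (prod_topology X unit_interval). (symclp (mapping_torus_glue X f))\<^sup>*\<^sup>* a b}"

definition mapping_torus :: "'a topology \<Rightarrow> ('a \<Rightarrow> 'a) \<Rightarrow> ('a \<times> real) set topology" where
  "mapping_torus X f =
     quotient_topology (prod_topology X unit_interval) (mapping_torus_proj X f)"


section \<open>Fibrations with unique path lifting\<close>

text \<open>The homotopy lifting property with respect to all spaces \<open>W\<close> cannot be quantified over
  types. The type of \<open>W\<close> chosen here is large enough to represent every test problem: a lifting
  problem \<open>(g, F)\<close> over an arbitrary \<open>W\<close> factors through a quotient of \<open>W\<close> by way of
  \<open>w \<mapsto> (g w, F (w, _))\<close>. See \<open>hurewicz_fibration_lift\<close> below, where \<open>W\<close> has an arbitrary type.\<close>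

definition hurewicz_fibration :: "'y topology \<Rightarrow> 'x topology \<Rightarrow> ('y \<Rightarrow> 'x) \<Rightarrow> bool" where
  "hurewicz_fibration Y X p \<longleftrightarrow>
     continuous_map Y X p \<and>
     (\<forall>(W :: ('y \<times> (real \<Rightarrow> 'x)) topology) g F.
        continuous_map W Y g \<and> continuous_map (prod_topology W unit_interval) X F \<and>
        (\<forall>w\<in>topspace W. F (w, 0) = p (g w)) \<longrightarrow>
        (\<exists>G. continuous_map (prod_topology W unit_interval) Y G \<and>
             (\<forall>w\<in>topspace W. G (w, 0) = g w) \<and>
             (\<forall>w\<in>topspace W. \<forall>t\<in>{0..1}. p (G (w, t)) = F (w, t))))"

definition unique_path_lifting :: "'y topology \<Rightarrow> ('y \<Rightarrow> 'x) \<Rightarrow> bool" where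
  "unique_path_lifting Y p \<longleftrightarrow>
     (\<forall>\<omega> \<omega>'. pathin Y \<omega> \<and> pathin Y \<omega>' \<and> \<omega> 0 = \<omega>' 0 \<and> (\<forall>t\<in>{0..1}. p (\<omega> t) = p (\<omega>' t)) \<longrightarrow>
        (\<forall>t\<in>{0..1}. \<omega> t = \<omega>' t))"

definition upl_fibration ::
  "'y topology \<Rightarrow> 'y \<Rightarrow> ('y \<Rightarrow> 'x) \<Rightarrow> 'x topology \<Rightarrow> 'x \<Rightarrow> bool" where
  "upl_fibration Y y p X x \<longleftrightarrow>
     hurewicz_fibration Y X p \<and> unique_path_lifting Y p \<and> path_connected_space Y \<and>
     y \<in> topspace Y \<and> p y = x"

definition upl_morphism ::
  "'y topology \<Rightarrow> 'y \<Rightarrow> ('y \<Rightarrow> 'x) \<Rightarrow> 'z topology \<Rightarrow> 'z \<Rightarrow> ('z \<Rightarrow> 'x) \<Rightarrow> ('y \<Rightarrow> 'z) \<Rightarrow> bool" where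
  "upl_morphism Y y p Z z r g \<longleftrightarrow>
     continuous_map Y Z g \<and> g y = z \<and> (\<forall>w\<in>topspace Y. r (g w) = p w)"

text \<open>Objects \<open>Z\<close> are taken on the type of functions \<open>real \<Rightarrow> 'x\<close>. Every object is isomorphic to
  one on this type: by unique path lifting, a point of the total space is determined by the
  projection of a path leading to it from the basepoint. See \<open>universal_upl_fibration_morphism\<close>
  below, where \<open>Z\<close> has an arbitrary type.\<close>

definition universal_upl_fibration ::
  "'y topology \<Rightarrow> 'y \<Rightarrow> ('y \<Rightarrow> 'x) \<Rightarrow> 'x topology \<Rightarrow> 'x \<Rightarrow> bool" where
  "universal_upl_fibration Y y p X x \<longleftrightarrow>
     upl_fibration Y y p X x \<and>
     (\<forall>(Z :: (real \<Rightarrow> 'x) topology) z r.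
        upl_fibration Z z r X x \<longrightarrow> (\<exists>g. upl_morphism Y y p Z z r g))"


section \<open>Inverse limits of covering projections\<close>

text \<open>As in Spanier, surjectivity is not demanded; over a path-connected base this only admits
  the empty covering in addition.\<close>

definition covering_projection :: "'y topology \<Rightarrow> 'x topology \<Rightarrow> ('y \<Rightarrow> 'x) \<Rightarrow> bool" where
  "covering_projection Y X p \<longleftrightarrow>
     continuous_map Y X p \<and>
     (\<forall>x\<in>topspace X. \<exists>U. openin X U \<and> x \<in> U \<and>
        (\<exists>\<V>. \<Union>\<V> = {y \<in> topspace Y. p y \<in> U} \<and> (\<forall>V\<in>\<V>. openin Y V) \<and> pairwise disjnt \<V> \<and>
             (\<forall>V\<in>\<V>. homeomorphic_map (subtopology Y V) (subtopology X U) p)))"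

definition directed_preorder :: "'i set \<Rightarrow> ('i \<Rightarrow> 'i \<Rightarrow> bool) \<Rightarrow> bool" where
  "directed_preorder \<Lambda> le \<longleftrightarrow>
     \<Lambda> \<noteq> {} \<and> (\<forall>i\<in>\<Lambda>. le i i) \<and>
     (\<forall>i\<in>\<Lambda>. \<forall>j\<in>\<Lambda>. \<forall>k\<in>\<Lambda>. le i j \<and> le j k \<longrightarrow> le i k) \<and>
     (\<forall>i\<in>\<Lambda>. \<forall>j\<in>\<Lambda>. \<exists>k\<in>\<Lambda>. le i k \<and> le j k)"

definition covering_inverse_system ::
  "'i set \<Rightarrow> ('i \<Rightarrow> 'i \<Rightarrow> bool) \<Rightarrow> ('i \<Rightarrow> 'y topology) \<Rightarrow> ('i \<Rightarrow> 'i \<Rightarrow> 'y \<Rightarrow> 'y) \<Rightarrow>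
   ('i \<Rightarrow> 'y \<Rightarrow> 'x) \<Rightarrow> 'x topology \<Rightarrow> bool" where
  "covering_inverse_system \<Lambda> le Y f p X \<longleftrightarrow>
     directed_preorder \<Lambda> le \<and>
     (\<forall>i\<in>\<Lambda>. covering_projection (Y i) X (p i)) \<and>
     (\<forall>i\<in>\<Lambda>. \<forall>j\<in>\<Lambda>. le i j \<longrightarrow>
        continuous_map (Y j) (Y i) (f i j) \<and> (\<forall>y\<in>topspace (Y j). p i (f i j y) = p j y)) \<and>
     (\<forall>i\<in>\<Lambda>. \<forall>j\<in>\<Lambda>. \<forall>k\<in>\<Lambda>. le i j \<and> le j k \<longrightarrow>
        (\<forall>y\<in>topspace (Y k). f i j (f j k y) = f i k y)) \<and>
     (\<forall>i\<in>\<Lambda>. \<forall>y\<in>topspace (Y i). f i i y = y)"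

definition inverse_limit ::
  "'i set \<Rightarrow> ('i \<Rightarrow> 'i \<Rightarrow> bool) \<Rightarrow> ('i \<Rightarrow> 'y topology) \<Rightarrow> ('i \<Rightarrow> 'i \<Rightarrow> 'y \<Rightarrow> 'y) \<Rightarrow>
   ('i \<Rightarrow> 'y) topology" where
  "inverse_limit \<Lambda> le Y f =
     subtopology (product_topology Y \<Lambda>) {y. \<forall>i\<in>\<Lambda>. \<forall>j\<in>\<Lambda>. le i j \<longrightarrow> f i j (y j) = y i}"


section \<open>Adequacy of the definitions\<close>

lemma openin_quotient_topology:
  "openin (quotient_topology X q) U \<longleftrightarrow>
     U \<subseteq> q ` topspace X \<and> openin X {x \<in> topspace X. q x \<in> U}"
proof -
  let ?L = "\<lambda>U. U \<subseteq> q ` topspace X \<and> openin X {x \<in> topspace X. q x \<in> U}"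
  have int: "?L (S \<inter> T)" if S: "?L S" and T: "?L T" for S T
  proof
    have eq: "{x \<in> topspace X. q x \<in> S \<inter> T} =
        {x \<in> topspace X. q x \<in> S} \<inter> {x \<in> topspace X. q x \<in> T}" by blast
    show "openin X {x \<in> topspace X. q x \<in> S \<inter> T}"
      unfolding eq using S T by (intro openin_Int) simp_all
    show "S \<inter> T \<subseteq> q ` topspace X" using S by (meson inf.coboundedI1)
  qed
  have un: "?L (\<Union>K)" if K: "\<forall>S\<in>K. ?L S" for K
  proof
    have eq: "{x \<in> topspace X. q x \<in> \<Union>K} = \<Union>((\<lambda>S. {x \<in> topspace X. q x \<in> S}) ` K)" by blast
    show "openin X {x \<in> topspace X. q x \<in> \<Union>K}"
      unfolding eq using K by (intro openin_Union) auto
    show "\<Union>K \<subseteq> q ` topspace X" using K by (intro Union_least) simp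
  qed
  have "istopology ?L"
    unfolding istopology_def using int un by blast
  then show ?thesis
    unfolding quotient_topology_def by (simp add: topology_inverse')
qed

lemma topspace_quotient_topology [simp]: "topspace (quotient_topology X q) = q ` topspace X"
proof
  show "topspace (quotient_topology X q) \<subseteq> q ` topspace X"
    unfolding topspace_def[of "quotient_topology X q"] openin_quotient_topology by auto
  have "{x \<in> topspace X. q x \<in> q ` topspace X} = topspace X" by auto
  then have "openin (quotient_topology X q) (q ` topspace X)"
    by (simp add: openin_quotient_topology)
  then show "q ` topspace X \<subseteq> topspace (quotient_topology X q)"
    by (rule openin_subset)
qed

lemma quotient_map_quotient_topology: "quotient_map X (quotient_topology X q) q"
  by (auto simp: quotient_map_def openin_quotient_topology)

lemma mapping_torus_proj_eq_iff:
  assumes "a \<in> topspace (prod_topology X unit_interval)" "b \<in> topspace (prod_topology X unit_interval)"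
  shows "mapping_torus_proj X f a = mapping_torus_proj X f b \<longleftrightarrow>
         (symclp (mapping_torus_glue X f))\<^sup>*\<^sup>* a b"
proof -
  let ?R = "(symclp (mapping_torus_glue X f))\<^sup>*\<^sup>*"
  have sym: "?R c d \<Longrightarrow> ?R d c" for c d
    by (rule rtranclp_symclp_sym)
  have eq: "?R a c \<longleftrightarrow> ?R b c" if "?R a b" for c
    using that sym by (meson rtranclp_trans)
  show ?thesis
  proof
    assume "mapping_torus_proj X f a = mapping_torus_proj X f b"
    moreover have "b \<in> mapping_torus_proj X f b"
      unfolding mapping_torus_proj_def using assms(2) by blast
    ultimately have "b \<in> mapping_torus_proj X f a" by simp
    then show "?R a b" unfolding mapping_torus_proj_def by blast
  next
    assume "?R a b"
    then show "mapping_torus_proj X f a = mapping_torus_proj X f b"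
      unfolding mapping_torus_proj_def using eq by blast
  qed
qed

lemma earring_shift_exists: "\<exists>f. is_earring_shift f"
proof -
  define c where "c = (\<lambda>z::real\<times>real. 2 * fst z / (2 * fst z + (fst z)\<^sup>2 + (snd z)\<^sup>2))"
  define f where "f = (\<lambda>z. c z *\<^sub>R z)"
  let ?E = "\<Union>m\<in>{1..}. earring_circle m"
  have circ: "z \<in> earring_circle m \<longleftrightarrow> (fst z)\<^sup>2 + (snd z)\<^sup>2 = 2 * fst z / real m"
    if "m \<ge> 1" for m z
  proof -
    have "z \<in> earring_circle m \<longleftrightarrow> (1 / real m - fst z)\<^sup>2 + (snd z)\<^sup>2 = (1 / real m)\<^sup>2"
    proof -
      obtain a b where z: "z = (a, b)" by force
      have "z \<in> earring_circle m \<longleftrightarrow> sqrt ((1 / real m - a)\<^sup>2 + b\<^sup>2) = 1 / real m"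
        by (simp add: z earring_circle_def dist_prod_def dist_real_def)
      also have "\<dots> \<longleftrightarrow> (1 / real m - a)\<^sup>2 + b\<^sup>2 = (1 / real m)\<^sup>2"
        using real_sqrt_eq_iff[of "(1 / real m - a)\<^sup>2 + b\<^sup>2" "(1 / real m)\<^sup>2"] by simp
      finally show ?thesis by (simp add: z)
    qed
    also have "\<dots> \<longleftrightarrow> (fst z)\<^sup>2 + (snd z)\<^sup>2 = 2 * fst z / real m"
      by (auto simp: power2_diff algebra_simps)
    finally show ?thesis .
  qed
  have pos: "fst z > 0" if "z \<in> earring_circle m" "m \<ge> 1" "z \<noteq> 0" for z m
  proof -
    have "(fst z)\<^sup>2 + (snd z)\<^sup>2 > 0"
      using that(3) by (metis prod_eq_iff sum_power2_gt_zero_iff fst_zero snd_zero)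
    with that circ have "2 * fst z / real m > 0" by simp
    with that show ?thesis by (simp add: zero_less_divide_iff)
  qed
  have cval: "f z = (real m / (real m + 1)) *\<^sub>R z" if "z \<in> earring_circle m" "m \<ge> 1" for z m
  proof (cases "z = 0")
    case False
    with pos that have a: "fst z > 0" by blast
    have "2 * fst z + (fst z)\<^sup>2 + (snd z)\<^sup>2 = 2 * fst z * ((real m + 1) / real m)"
      using circ[OF that(2), of z] that by (simp add: field_simps)
    then have "c z = real m / (real m + 1)"
      unfolding c_def using a that(2) by simp
    then show ?thesis by (simp add: f_def)
  qed (simp add: f_def)
  have img: "f z \<in> earring_circle (Suc m)" if "z \<in> earring_circle m" "m \<ge> 1" for z m
  proof -
    let ?k = "real m / (real m + 1)"
    have eq: "(fst z)\<^sup>2 + (snd z)\<^sup>2 = 2 * fst z / real m" using circ that by simp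
    have "(?k * fst z)\<^sup>2 + (?k * snd z)\<^sup>2 = ?k\<^sup>2 * ((fst z)\<^sup>2 + (snd z)\<^sup>2)"
      by (simp only: power_mult_distrib distrib_left)
    also have "\<dots> = 2 * (?k * fst z) / (real m + 1)"
      unfolding eq using that by (simp add: power2_eq_square)
    finally show ?thesis
      using cval[OF that] circ[of "Suc m" "f z"] by (simp add: add.commute)
  qed
  have cont: "continuous_on ?E f"
    unfolding continuous_on_eq_continuous_within
  proof
    fix z assume "z \<in> ?E"
    then obtain m where m: "m \<ge> 1" "z \<in> earring_circle m" by auto
    show "continuous (at z within ?E) f"
    proof (cases "z = 0")
      case True
      have "norm (f w) \<le> norm w" if w: "w \<in> ?E" for w
      proof -
        from w obtain n where n: "n \<ge> 1" "w \<in> earring_circle n" by auto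
        have "norm (f w) = (real n / (real n + 1)) * norm w"
          using cval[OF n(2) n(1)] by simp
        also have "\<dots> \<le> 1 * norm w" by (intro mult_right_mono) auto
        finally show ?thesis by simp
      qed
      then have ev: "eventually (\<lambda>w. norm (f w) \<le> norm w) (at 0 within ?E)"
        by (auto simp: eventually_at_filter)
      have "((\<lambda>w. norm w) \<longlongrightarrow> 0) (at (0::real\<times>real) within ?E)"
        by (intro tendsto_norm_zero) (rule tendsto_ident_at)
      then have "(f \<longlongrightarrow> 0) (at 0 within ?E)"
        by (rule Lim_null_comparison[OF ev])
      then show ?thesis using True by (simp add: continuous_within f_def)
    next
      case False
      with pos m have a: "fst z > 0" by blast
      have "2 * fst z + (fst z)\<^sup>2 + (snd z)\<^sup>2 > 0"
        using a by (simp add: add_pos_nonneg)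
      then show ?thesis unfolding f_def c_def
        by (intro continuous_intros) auto
    qed
  qed
  have loop: "earring_loop m t \<in> earring_circle m" if "m \<ge> 1" for m t
  proof -
    have "(1 - cos (2 * pi * t))\<^sup>2 + (sin (2 * pi * t))\<^sup>2 = 2 * (1 - cos (2 * pi * t))"
      using sin_cos_squared_add[of "2 * pi * t"] by (simp add: power2_diff)
    then have "(1 / real m * (1 - cos (2 * pi * t)))\<^sup>2 + (1 / real m * sin (2 * pi * t))\<^sup>2 =
               (1 / real m)\<^sup>2 * (2 * (1 - cos (2 * pi * t)))"
      by (simp only: power_mult_distrib flip: distrib_left)
    also have "\<dots> = 2 * (1 / real m * (1 - cos (2 * pi * t))) / real m"
      by (simp add: power2_eq_square)
    finally show ?thesis
      using that by (simp add: circ earring_loop_def)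
  qed
  have "f (earring_loop m t) = earring_loop (Suc m) t" if "m \<ge> 1" for m t
    using cval[OF loop[OF that] that] that by (simp add: earring_loop_def add.commute)
  moreover have "f ` ?E \<subseteq> ?E"
    using img by fastforce
  then have "f \<in> ?E \<rightarrow> ?E"
    by (simp only: image_subset_iff_funcset)
  then have "continuous_map hawaiian_earring hawaiian_earring f"
    using cont by (simp add: hawaiian_earring_def)
  ultimately show ?thesis
    unfolding is_earring_shift_def by blast
qed

lemma earring_circle_loop:
  assumes "m \<ge> 1" "z \<in> earring_circle m"
  shows "\<exists>t\<in>{0..1}. z = earring_loop m t"
proof -
  obtain a b where z: "z = (a, b)" by force
  have "sqrt ((1 / real m - a)\<^sup>2 + b\<^sup>2) = 1 / real m"
    using assms by (simp add: z earring_circle_def dist_prod_def dist_real_def)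
  then have "(1 / real m - a)\<^sup>2 + b\<^sup>2 = (1 / real m)\<^sup>2"
    by (metis real_sqrt_pow2_iff sum_power2_ge_zero)
  then have "(real m)\<^sup>2 * ((1 / real m - a)\<^sup>2 + b\<^sup>2) = (real m)\<^sup>2 * (1 / real m)\<^sup>2"
    by (rule arg_cong)
  then have "(real m * (1 / real m - a))\<^sup>2 + (real m * b)\<^sup>2 = (real m * (1 / real m))\<^sup>2"
    by (simp only: power_mult_distrib distrib_left)
  moreover have "real m * (1 / real m - a) = 1 - real m * a" "real m * (1 / real m) = 1"
    using assms(1) by (simp_all add: right_diff_distrib)
  ultimately have "(1 - real m * a)\<^sup>2 + (real m * b)\<^sup>2 = 1"
    by simp
  then obtain s where s: "0 \<le> s" "s < 2 * pi" "1 - real m * a = cos s" "real m * b = sin s"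
    by (metis sincos_total_2pi)
  have "a = 1 / real m * (1 - cos s)" "b = 1 / real m * sin s"
    using s(3,4) assms(1) by (simp_all flip: s(3,4))
  then have "z = earring_loop m (s / (2 * pi))"
    by (simp add: z earring_loop_def)
  moreover have "s / (2 * pi) \<in> {0..1}" using s by simp
  ultimately show ?thesis by blast
qed

lemma earring_shift_unique:
  assumes "is_earring_shift f" "is_earring_shift f'" "z \<in> topspace hawaiian_earring"
  shows "f z = f' z"
proof -
  obtain m where m: "m \<ge> 1" "z \<in> earring_circle m"
    using assms(3) by (auto simp: hawaiian_earring_def)
  then obtain t where "t \<in> {0..1}" "z = earring_loop m t"
    using earring_circle_loop by blast
  then show ?thesis using assms(1,2) m(1) by (simp add: is_earring_shift_def)
qed

lemma hurewicz_fibration_lift: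
  fixes W :: "'w topology" and Y :: "'y topology" and X :: "'x topology"
  assumes p: "hurewicz_fibration Y X p"
    and g: "continuous_map W Y g"
    and F: "continuous_map (prod_topology W unit_interval) X F"
    and eq: "\<And>w. w \<in> topspace W \<Longrightarrow> F (w, 0) = p (g w)"
  obtains G where "continuous_map (prod_topology W unit_interval) Y G"
    and "\<And>w. w \<in> topspace W \<Longrightarrow> G (w, 0) = g w"
    and "\<And>w t. w \<in> topspace W \<Longrightarrow> t \<in> {0..1} \<Longrightarrow> p (G (w, t)) = F (w, t)"
proof -
  define q where "q = (\<lambda>w. (g w, \<lambda>t. F (w, t)))"
  define W' where "W' = quotient_topology W q"
  define F' where "F' = (\<lambda>(e :: 'y \<times> (real \<Rightarrow> 'x), t :: real). snd e t)"
  have q: "quotient_map W W' q"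
    unfolding W'_def by (rule quotient_map_quotient_topology)
  have qI: "quotient_map (prod_topology W unit_interval) (prod_topology W' unit_interval)
              (\<lambda>(w, t). (q w, t))"
  proof (rule quotient_map_prod_left[OF _ _ q])
    show "locally_compact_space unit_interval"
      by (simp add: compact_imp_locally_compact_space compact_space_subtopology)
    show "Hausdorff_space unit_interval \<or> regular_space unit_interval"
      by (simp add: Hausdorff_space_subtopology)
  qed
  have "fst \<circ> q = g" by (auto simp: q_def)
  then have g': "continuous_map W' Y fst"
    using continuous_compose_quotient_map[OF q] g by metis
  have "F' \<circ> (\<lambda>(w, t). (q w, t)) = F" by (auto simp: F'_def q_def)
  then have F': "continuous_map (prod_topology W' unit_interval) X F'"
    using continuous_compose_quotient_map[OF qI] F by metis
  have "\<forall>e\<in>topspace W'. F' (e, 0) = p (fst e)"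
    by (auto simp: W'_def F'_def q_def eq)
  with p g' F' obtain G' where G':
    "continuous_map (prod_topology W' unit_interval) Y G'"
    "\<forall>e\<in>topspace W'. G' (e, 0) = fst e"
    "\<forall>e\<in>topspace W'. \<forall>t\<in>{0..1}. p (G' (e, t)) = F' (e, t)"
    unfolding hurewicz_fibration_def by metis
  have W': "q w \<in> topspace W'" if "w \<in> topspace W" for w
    using that by (simp add: W'_def)
  show ?thesis
  proof (rule that)
    show "continuous_map (prod_topology W unit_interval) Y (G' \<circ> (\<lambda>(w, t). (q w, t)))"
      using continuous_map_compose[OF quotient_imp_continuous_map[OF qI] G'(1)] .
  qed (use G'(2,3) W' in \<open>auto simp: q_def F'_def\<close>)
qed

lemma universal_upl_fibration_morphism:
  fixes Z :: "'z topology"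
  assumes univ: "universal_upl_fibration Y y p X x" and Z: "upl_fibration Z z r X x"
  shows "\<exists>g. upl_morphism Y y p Z z r g"
proof -
  have fib: "hurewicz_fibration Z X r" and upl: "unique_path_lifting Z r"
    and pc: "path_connected_space Z" and z: "z \<in> topspace Z" "r z = x"
    using Z by (auto simp: upl_fibration_def)
  have "\<forall>v\<in>topspace Z. \<exists>\<gamma>. pathin Z \<gamma> \<and> \<gamma> 0 = z \<and> \<gamma> 1 = v"
    using pc z by (auto simp: path_connected_space_def)
  then obtain \<gamma> where \<gamma>: "\<And>v. v \<in> topspace Z \<Longrightarrow> pathin Z (\<gamma> v) \<and> \<gamma> v 0 = z \<and> \<gamma> v 1 = v"
    by metis
  define j where "j = (\<lambda>v t. r (\<gamma> v t))"
  have inj: "inj_on j (topspace Z)"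
  proof (rule inj_onI)
    fix u v assume uv: "u \<in> topspace Z" "v \<in> topspace Z" "j u = j v"
    then have "\<forall>t\<in>{0..1}. r (\<gamma> u t) = r (\<gamma> v t)" by (auto simp: j_def dest: fun_cong)
    then have "\<forall>t\<in>{0..1}. \<gamma> u t = \<gamma> v t"
      using upl \<gamma>[OF uv(1)] \<gamma>[OF uv(2)] unfolding unique_path_lifting_def by metis
    then have "\<gamma> u 1 = \<gamma> v 1" by simp
    with \<gamma> uv show "u = v" by metis
  qed
  define Z' where "Z' = quotient_topology Z j"
  have hom: "homeomorphic_map Z Z' j"
    unfolding homeomorphic_map_def Z'_def using inj quotient_map_quotient_topology by blast
  then obtain k where k: "homeomorphic_maps Z Z' j k"
    using homeomorphic_map_maps by blast
  have cj: "continuous_map Z Z' j" and ck: "continuous_map Z' Z k"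
    and kj: "\<And>v. v \<in> topspace Z \<Longrightarrow> k (j v) = v" and jk: "\<And>e. e \<in> topspace Z' \<Longrightarrow> j (k e) = e"
    using k by (auto simp: homeomorphic_maps_def)
  have kZ: "k e \<in> topspace Z" if "e \<in> topspace Z'" for e
    using ck that by (auto simp: continuous_map_def)
  have jZ: "j v \<in> topspace Z'" if "v \<in> topspace Z" for v
    using cj that by (auto simp: continuous_map_def)
  have "hurewicz_fibration Z' X (r \<circ> k)"
    unfolding hurewicz_fibration_def
  proof (intro conjI allI impI; (elim conjE)?)
    show "continuous_map Z' X (r \<circ> k)"
      using ck fib continuous_map_compose by (auto simp: hurewicz_fibration_def)
  next
    fix W :: "((real \<Rightarrow> 'b) \<times> (real \<Rightarrow> 'b)) topology" and g F
    assume W: "continuous_map W Z' g" "continuous_map (prod_topology W unit_interval) X F"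
      "\<forall>w\<in>topspace W. F (w, 0) = (r \<circ> k) (g w)"
    have "continuous_map W Z (k \<circ> g)" using W(1) ck continuous_map_compose by blast
    then obtain G where G: "continuous_map (prod_topology W unit_interval) Z G"
      "\<And>w. w \<in> topspace W \<Longrightarrow> G (w, 0) = (k \<circ> g) w"
      "\<And>w t. w \<in> topspace W \<Longrightarrow> t \<in> {0..1} \<Longrightarrow> r (G (w, t)) = F (w, t)"
      by (rule hurewicz_fibration_lift[OF fib _ W(2)]) (use W(3) in auto)
    have GZ: "G (w, t) \<in> topspace Z" if "w \<in> topspace W" "t \<in> {0..1}" for w t
      using G(1) that by (auto simp: continuous_map_def Pi_iff)
    have gZ: "g w \<in> topspace Z'" if "w \<in> topspace W" for w
      using W(1) that by (auto simp: continuous_map_def)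
    show "\<exists>G. continuous_map (prod_topology W unit_interval) Z' G \<and>
            (\<forall>w\<in>topspace W. G (w, 0) = g w) \<and>
            (\<forall>w\<in>topspace W. \<forall>t\<in>{0..1}. (r \<circ> k) (G (w, t)) = F (w, t))"
    proof (intro exI[of _ "j \<circ> G"] conjI ballI)
      show "continuous_map (prod_topology W unit_interval) Z' (j \<circ> G)"
        using G(1) cj continuous_map_compose by blast
    qed (use G(2,3) GZ gZ kj jk in auto)
  qed
  moreover have "unique_path_lifting Z' (r \<circ> k)"
    unfolding unique_path_lifting_def
  proof (intro allI impI; elim conjE)
    fix \<omega> \<omega>'
    assume *: "pathin Z' \<omega>" "pathin Z' \<omega>'" "\<omega> 0 = \<omega>' 0" "\<forall>t\<in>{0..1}. (r \<circ> k) (\<omega> t) = (r \<circ> k) (\<omega>' t)"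
    have "pathin Z (k \<circ> \<omega>)" "pathin Z (k \<circ> \<omega>')"
      using *(1,2) ck by (auto intro: pathin_compose)
    with upl *(3,4) have eq: "\<forall>t\<in>{0..1}. (k \<circ> \<omega>) t = (k \<circ> \<omega>') t"
      unfolding unique_path_lifting_def
      by (elim allE[of _ "k \<circ> \<omega>"] allE[of _ "k \<circ> \<omega>'"]) simp
    have "\<omega> t \<in> topspace Z'" "\<omega>' t \<in> topspace Z'" if "t \<in> {0..1}" for t
      using *(1,2) that by (auto simp: pathin_def continuous_map_def)
    note Z' = this
    show "\<forall>t\<in>{0..1}. \<omega> t = \<omega>' t"
    proof
      fix t :: real assume t: "t \<in> {0..1}"
      then have "j (k (\<omega> t)) = j (k (\<omega>' t))" using eq by simp
      then show "\<omega> t = \<omega>' t" using jk Z' t by simp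
    qed
  qed
  moreover have "path_connected_space Z'"
    using pc hom path_connected_space_quotient_map_image unfolding homeomorphic_map_def by blast
  moreover have "j z \<in> topspace Z'" "(r \<circ> k) (j z) = x" using z jZ kj by auto
  ultimately have "upl_fibration Z' (j z) (r \<circ> k) X x"
    by (simp add: upl_fibration_def)
  with univ obtain g where g: "upl_morphism Y y p Z' (j z) (r \<circ> k) g"
    unfolding universal_upl_fibration_def by blast
  have "upl_morphism Y y p Z z r (k \<circ> g)"
    using g ck kj z unfolding upl_morphism_def by (auto intro: continuous_map_compose)
  then show ?thesis by blast
qed

lemma covering_space_iff_covering_projection:
  "covering_space c p S \<longleftrightarrow> covering_projection (top_of_set c) (top_of_set S) p \<and> p ` c = S"
proof -
  have hom: "(\<exists>q. homeomorphism V U p q) \<longleftrightarrow>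
             homeomorphic_map (subtopology (top_of_set c) V) (subtopology (top_of_set S) U) p"
    if "V \<subseteq> c" "U \<subseteq> S" for V U
  proof -
    have "subtopology (top_of_set c) V = top_of_set V" "subtopology (top_of_set S) U = top_of_set U"
      using that by (simp_all add: subtopology_subtopology Int_absorb1)
    moreover have "homeomorphic_maps (top_of_set V) (top_of_set U) p q \<longleftrightarrow> homeomorphism V U p q" for q
    proof
      assume "homeomorphic_maps (top_of_set V) (top_of_set U) p q"
      then have "continuous_on V p" "p ` V \<subseteq> U" "continuous_on U q" "q ` U \<subseteq> V"
        "\<forall>v\<in>V. q (p v) = v" "\<forall>w\<in>U. p (q w) = w"
        by (auto simp: homeomorphic_maps_def)
      then show "homeomorphism V U p q"
        by (intro homeomorphismI) auto
    next
      assume "homeomorphism V U p q"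
      then show "homeomorphic_maps (top_of_set V) (top_of_set U) p q"
        by (auto simp: homeomorphic_maps_def homeomorphism_def)
    qed
    ultimately show ?thesis by (simp add: homeomorphic_map_maps)
  qed
  have ev: "(\<exists>\<V>. \<Union>\<V> = c \<inter> p -` U \<and> (\<forall>V\<in>\<V>. openin (top_of_set c) V) \<and> pairwise disjnt \<V> \<and>
                (\<forall>V\<in>\<V>. \<exists>q. homeomorphism V U p q)) \<longleftrightarrow>
            (\<exists>\<V>. \<Union>\<V> = {y \<in> topspace (top_of_set c). p y \<in> U} \<and>
                (\<forall>V\<in>\<V>. openin (top_of_set c) V) \<and> pairwise disjnt \<V> \<and>
                (\<forall>V\<in>\<V>. homeomorphic_map (subtopology (top_of_set c) V)
                              (subtopology (top_of_set S) U) p))"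
    if "openin (top_of_set S) U" for U
  proof -
    have "c \<inter> p -` U = {y \<in> topspace (top_of_set c). p y \<in> U}" by auto
    moreover have "U \<subseteq> S" using that by (rule openin_imp_subset)
    then have "(\<forall>V\<in>\<V>. \<exists>q. homeomorphism V U p q) \<longleftrightarrow>
        (\<forall>V\<in>\<V>. homeomorphic_map (subtopology (top_of_set c) V) (subtopology (top_of_set S) U) p)"
      if "\<forall>V\<in>\<V>. openin (top_of_set c) V" for \<V>
      using that hom by (intro ball_cong refl) (metis openin_imp_subset)
    ultimately show ?thesis
      by (intro ex_cong1 conj_cong refl) (simp_all only:)
  qed
  have gen: "(\<forall>x\<in>S. \<exists>U. x \<in> U \<and> P U \<and> A U) \<longleftrightarrow> (\<forall>x\<in>S. \<exists>U. P U \<and> x \<in> U \<and> B U)"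
    if "\<And>U. P U \<Longrightarrow> A U \<longleftrightarrow> B U" for P A B
    using that by blast
  have cont: "continuous_map (top_of_set c) (top_of_set S) p \<longleftrightarrow> continuous_on c p"
    if "p ` c = S"
    using that by auto
  show ?thesis
  proof (cases "p ` c = S")
    case True
    then show ?thesis
      unfolding covering_space_def covering_projection_def cont[OF True] topspace_euclidean_subtopology
      using gen[OF ev] by (simp only: topspace_euclidean_subtopology simp_thms)
  qed (simp add: covering_space_def)
qed

end

(* If the universal object were a path component of a limit of coverings, then l_1 would lift to a
closed loop in it: in a covering all sufficiently small loops l_m have closed lifts, and the
cylinders over the l_m are free homotopies from l_m to l_(m+1), so that closedness descends to
l_1. Morphisms out of the universal object preserve this. But composing two pullbacks of the
covering of the circle by the line gives a fibration with unique path lifting in which l_1 does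
not close up: the first is the infinite cyclic cover of the mapping torus, the second unwinds,
over the strip E x [k,k+1] of that cover, the circle C_(k+1). The composite is not a covering
because these unwound circles shrink to a point. *)
theory Submission
  imports Defs
begin

text \<open>No circle-valued map on the mapping torus itself can detect l_1, since that loop is
  freely homotopic to arbitrarily small ones. On the infinite cyclic cover the strips can be told
  apart, so the circle that is watched may depend on the strip. The shift carries C_(k+1) at the end
  of strip k onto C_(k+2) at the start of strip k + 1, hence watching C_(k+1) over strip k is
  compatible with the gluing. Nothing has to be watched below strip 0, because the shift carries no
  circle onto C_1.\<close>

section \<open>Sheets of coverings and unique path lifting\<close>

lemma connectedin_disjoint_open_cover:
  assumes "connectedin Y S" "S \<noteq> {}" "S \<subseteq> \<Union>\<V>" "\<And>V. V \<in> \<V> \<Longrightarrow> openin Y V" "pairwise disjnt \<V>"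
  obtains V where "V \<in> \<V>" "S \<subseteq> V"
proof -
  obtain y V where V: "y \<in> S" "y \<in> V" "V \<in> \<V>" using assms(2,3) by blast
  have "openin Y (\<Union>(\<V> - {V}))" using assms(4) by blast
  moreover have "V \<inter> \<Union>(\<V> - {V}) = {}"
    using assms(5) V(3) by (auto simp: pairwise_def disjnt_iff)
  ultimately have "V \<inter> S = {} \<or> \<Union>(\<V> - {V}) \<inter> S = {}"
    using connectedinD[OF assms(1) assms(4)[OF V(3)], of "\<Union>(\<V> - {V})"] assms(3) V(3) by blast
  then have "S \<subseteq> V" using V assms(3) by blast
  then show ?thesis using that V(3) by blast
qed

lemma covering_projection_evenly_covered:
  assumes "covering_projection Y X p" "x \<in> topspace X"
  obtains U \<V> where "openin X U" "x \<in> U" "\<Union>\<V> = {y \<in> topspace Y. p y \<in> U}"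
    "\<And>V. V \<in> \<V> \<Longrightarrow> openin Y V" "pairwise disjnt \<V>" "\<And>V. V \<in> \<V> \<Longrightarrow> inj_on p V"
proof -
  have "\<exists>U. openin X U \<and> x \<in> U \<and>
        (\<exists>\<V>. \<Union>\<V> = {y \<in> topspace Y. p y \<in> U} \<and> (\<forall>V\<in>\<V>. openin Y V) \<and> pairwise disjnt \<V> \<and>
             (\<forall>V\<in>\<V>. homeomorphic_map (subtopology Y V) (subtopology X U) p))"
    using assms unfolding covering_projection_def by (elim conjE) (rule bspec)
  then show ?thesis
  proof (elim exE conjE)
    fix U \<V>
    assume U: "openin X U" "x \<in> U" "\<Union>\<V> = {y \<in> topspace Y. p y \<in> U}"
      "\<forall>V\<in>\<V>. openin Y V" "pairwise disjnt \<V>"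
      and hom: "\<forall>V\<in>\<V>. homeomorphic_map (subtopology Y V) (subtopology X U) p"
    have "inj_on p V" if "V \<in> \<V>" for V
    proof -
      have "topspace (subtopology Y V) = V" using U(4) that openin_subset by fastforce
      then show ?thesis using hom that homeomorphic_imp_injective_map by metis
    qed
    then show ?thesis using that[OF U(1-3) _ U(5)] U(4) by simp
  qed
qed

lemma unique_path_liftingD:
  assumes "unique_path_lifting Y p" "pathin Y \<omega>" "pathin Y \<omega>'" "\<omega> 0 = \<omega>' 0"
    and "\<And>t. t \<in> {0..1} \<Longrightarrow> p (\<omega> t) = p (\<omega>' t)" "t \<in> {0..1}"
  shows "\<omega> t = \<omega>' t"
  using assms(1)[unfolded unique_path_lifting_def, rule_format, of \<omega> \<omega>' t] assms(2-) by simp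

text \<open>Agreement of the two paths is a locally constant condition, so it spreads over the
  connected interval. Near \<open>a\<close> each path stays in one sheet; if they agree anywhere
  there, disjointness makes the two sheets equal, and injectivity of \<open>p\<close> on that sheet
  makes the paths agree throughout the neighbourhood.\<close>

lemma covering_projection_unique_path_lifting:
  assumes "covering_projection Y X p"
  shows "unique_path_lifting Y p"
  unfolding unique_path_lifting_def
proof (intro allI impI ballI; elim conjE)
  fix \<omega> \<omega>' :: "real \<Rightarrow> 'a" and t :: real
  assume \<omega>: "pathin Y \<omega>" "pathin Y \<omega>'" "\<omega> 0 = \<omega>' 0" and eq: "\<forall>t\<in>{0..1}. p (\<omega> t) = p (\<omega>' t)"
    and t: "t \<in> {0..1}"
  show "\<omega> t = \<omega>' t"
  proof (rule connected_induction_simple[of "{0..1}" 0 t "\<lambda>t. \<omega> t = \<omega>' t"])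
    fix a :: real assume a: "a \<in> {0..1}"
    have Y: "\<omega> b \<in> topspace Y" "\<omega>' b \<in> topspace Y" if "b \<in> {0..1}" for b
      using that \<omega> by (auto simp: pathin_def continuous_map_def)
    have "p (\<omega> a) \<in> topspace X"
      using assms Y[OF a] by (auto simp: covering_projection_def continuous_map_def)
    then obtain U \<V> where U: "openin X U" "p (\<omega> a) \<in> U"
      "\<Union>\<V> = {y \<in> topspace Y. p y \<in> U}" "\<And>V. V \<in> \<V> \<Longrightarrow> openin Y V" "pairwise disjnt \<V>"
      "\<And>V. V \<in> \<V> \<Longrightarrow> inj_on p V"
      by (rule covering_projection_evenly_covered[OF assms]) blast
    have "\<omega> a \<in> \<Union>\<V>" "\<omega>' a \<in> \<Union>\<V>" using U(2,3) Y[OF a] eq a by auto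
    then obtain V V' where V: "V \<in> \<V>" "\<omega> a \<in> V" and V': "V' \<in> \<V>" "\<omega>' a \<in> V'" by blast
    let ?T = "{b \<in> {0..1}. \<omega> b \<in> V} \<inter> {b \<in> {0..1}. \<omega>' b \<in> V'}"
    have "openin unit_interval ?T"
      using \<omega>(1,2) U(4) V(1) V'(1) unfolding pathin_def continuous_map_def
      by (intro openin_Int) auto
    moreover have "\<forall>x\<in>?T. \<forall>y\<in>?T. \<omega> x = \<omega>' x \<longrightarrow> \<omega> y = \<omega>' y"
    proof (intro ballI impI)
      fix x y assume xy: "x \<in> ?T" "y \<in> ?T" "\<omega> x = \<omega>' x"
      then have "V = V'" using U(5) V(1) V'(1) by (auto simp: pairwise_def disjnt_iff)
      then show "\<omega> y = \<omega>' y" using U(6)[OF V(1)] xy eq by (auto simp: inj_on_def)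
    qed
    ultimately show "\<exists>T. openin unit_interval T \<and> a \<in> T \<and>
        (\<forall>x\<in>T. \<forall>y\<in>T. \<omega> x = \<omega>' x \<longrightarrow> \<omega> y = \<omega>' y)"
      using a V(2) V'(2) by blast
  qed (use t \<omega> in auto)
qed

section \<open>Fibrations: lifting of paths, composites, path components\<close>

lemma homotopy_pathin:
  assumes "continuous_map (prod_topology W unit_interval) Y G" "w \<in> topspace W"
  shows "pathin Y (\<lambda>t. G (w, t))"
proof -
  have "continuous_map unit_interval (prod_topology W unit_interval) (\<lambda>t. (w, t))"
    using assms(2) by (intro continuous_map_pairedI) auto
  then show ?thesis
    unfolding pathin_def using continuous_map_compose[OF _ assms(1)] by (simp add: o_def)
qed

lemma hurewicz_fibration_lift_path:
  assumes "hurewicz_fibration Y X p" "pathin X \<gamma>" "y \<in> topspace Y" "p y = \<gamma> 0"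
  obtains \<omega> where "pathin Y \<omega>" "\<omega> 0 = y" "\<And>t. t \<in> {0..1} \<Longrightarrow> p (\<omega> t) = \<gamma> t"
proof -
  \<comment> \<open>Lifting a path is lifting a homotopy with a one-point parameter space.\<close>
  let ?W = "discrete_topology {()}"
  have "continuous_map ?W Y (\<lambda>_. y)" using assms(3) by simp
  moreover have "continuous_map (prod_topology ?W unit_interval) X (\<gamma> \<circ> snd)"
    using assms(2) unfolding pathin_def by (rule continuous_map_compose[OF continuous_map_snd])
  ultimately obtain G where "continuous_map (prod_topology ?W unit_interval) Y G"
    "\<And>w. w \<in> topspace ?W \<Longrightarrow> G (w, 0) = y"
    "\<And>w t. w \<in> topspace ?W \<Longrightarrow> t \<in> {0..1} \<Longrightarrow> p (G (w, t)) = (\<gamma> \<circ> snd) (w, t)"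
    by (rule hurewicz_fibration_lift[OF assms(1)]) (auto simp: assms(4))
  then show ?thesis
    using that[of "\<lambda>t. G ((), t)"] homotopy_pathin[of ?W Y G "()"] by simp
qed

lemma hurewicz_fibration_compose:
  assumes p: "hurewicz_fibration Y X p" and q: "hurewicz_fibration Z Y q"
  shows "hurewicz_fibration Z X (p \<circ> q)"
  unfolding hurewicz_fibration_def
proof (intro conjI allI impI; (elim conjE)?)
  show "continuous_map Z X (p \<circ> q)"
    using p q continuous_map_compose by (auto simp: hurewicz_fibration_def)
  fix W :: "('c \<times> (real \<Rightarrow> 'b)) topology" and g F
  assume g: "continuous_map W Z g" and F: "continuous_map (prod_topology W unit_interval) X F"
    and eq: "\<forall>w\<in>topspace W. F (w, 0) = (p \<circ> q) (g w)"
  have "continuous_map W Y (q \<circ> g)"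
    using g q continuous_map_compose by (auto simp: hurewicz_fibration_def)
  then obtain G where G: "continuous_map (prod_topology W unit_interval) Y G"
    "\<And>w. w \<in> topspace W \<Longrightarrow> G (w, 0) = (q \<circ> g) w"
    "\<And>w t. w \<in> topspace W \<Longrightarrow> t \<in> {0..1} \<Longrightarrow> p (G (w, t)) = F (w, t)"
    by (rule hurewicz_fibration_lift[OF p _ F]) (use eq in auto)
  obtain H where "continuous_map (prod_topology W unit_interval) Z H"
    "\<And>w. w \<in> topspace W \<Longrightarrow> H (w, 0) = g w"
    "\<And>w t. w \<in> topspace W \<Longrightarrow> t \<in> {0..1} \<Longrightarrow> q (H (w, t)) = G (w, t)"
    by (rule hurewicz_fibration_lift[OF q g G(1)]) (use G(2) in auto)
  then show "\<exists>G. continuous_map (prod_topology W unit_interval) Z G \<and>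
      (\<forall>w\<in>topspace W. G (w, 0) = g w) \<and>
      (\<forall>w\<in>topspace W. \<forall>t\<in>{0..1}. (p \<circ> q) (G (w, t)) = F (w, t))"
    using G(3) by (intro exI[of _ H]) simp
qed

lemma unique_path_lifting_compose:
  assumes p: "unique_path_lifting Y p" and q: "unique_path_lifting Z q" and "continuous_map Z Y q"
  shows "unique_path_lifting Z (p \<circ> q)"
  unfolding unique_path_lifting_def
proof (intro allI impI; elim conjE)
  fix \<omega> \<omega>' assume *: "pathin Z \<omega>" "pathin Z \<omega>'" "\<omega> 0 = \<omega>' 0"
    "\<forall>t\<in>{0..1}. (p \<circ> q) (\<omega> t) = (p \<circ> q) (\<omega>' t)"
  have "pathin Y (q \<circ> \<omega>)" "pathin Y (q \<circ> \<omega>')"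
    using *(1,2) assms(3) by (auto intro: pathin_compose)
  then have "(q \<circ> \<omega>) t = (q \<circ> \<omega>') t" if "t \<in> {0..1}" for t
    by (rule unique_path_liftingD[OF p _ _ _ _ that]) (use *(3,4) in auto)
  then show "\<forall>t\<in>{0..1}. \<omega> t = \<omega>' t"
    by (intro ballI unique_path_liftingD[OF q *(1-3)]) auto
qed

text \<open>Each track of a lifted homotopy is a path that starts at \<open>g w\<close>, so it
  cannot leave the path component. Passing to a component supplies the path-connected total space
  that an object must have, without deciding whether the pullbacks constructed below are
  path-connected.\<close>

lemma upl_fibration_path_component:
  assumes p: "hurewicz_fibration Y X p" and upl: "unique_path_lifting Y p" and y: "y \<in> topspace Y"
  shows "upl_fibration (subtopology Y (path_component_of_set Y y)) y p X (p y)"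
proof -
  let ?C = "path_component_of_set Y y"
  have cont: "continuous_map (subtopology Y ?C) X p"
    using p by (simp add: hurewicz_fibration_def continuous_map_from_subtopology)
  have "hurewicz_fibration (subtopology Y ?C) X p"
    unfolding hurewicz_fibration_def
  proof (intro conjI allI impI cont; elim conjE)
    fix W :: "('a \<times> (real \<Rightarrow> 'b)) topology" and g F
    assume g: "continuous_map W (subtopology Y ?C) g"
      and F: "continuous_map (prod_topology W unit_interval) X F"
      and eq: "\<forall>w\<in>topspace W. F (w, 0) = p (g w)"
    have "continuous_map W Y g" using g by (simp add: continuous_map_in_subtopology)
    then obtain G where G: "continuous_map (prod_topology W unit_interval) Y G"
      "\<And>w. w \<in> topspace W \<Longrightarrow> G (w, 0) = g w"
      "\<And>w t. w \<in> topspace W \<Longrightarrow> t \<in> {0..1} \<Longrightarrow> p (G (w, t)) = F (w, t)"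
      by (rule hurewicz_fibration_lift[OF p _ F]) (use eq in auto)
    have "G (w, t) \<in> ?C" if w: "w \<in> topspace W" and t: "t \<in> {0..1}" for w t
    proof -
      have "path_connectedin Y ((\<lambda>t. G (w, t)) ` {0..1})"
        using homotopy_pathin[OF G(1) w] unfolding pathin_def
        by (rule path_connectedin_continuous_map_image)
          (simp add: path_connectedin_subtopology convex_imp_path_connected)
      moreover have "g w \<in> (\<lambda>t. G (w, t)) ` {0..1}"
        using G(2)[OF w] by (metis atLeastAtMost_iff image_eqI order_refl zero_le_one)
      ultimately have "(\<lambda>t. G (w, t)) ` {0..1} \<subseteq> path_component_of_set Y (g w)"
        by (rule path_component_of_maximal)
      then have "path_component_of Y (g w) (G (w, t))" using t by blast
      moreover have "path_component_of Y y (g w)"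
        using g w by (auto simp: continuous_map_in_subtopology)
      ultimately show ?thesis by (auto intro: path_component_of_trans)
    qed
    then have "continuous_map (prod_topology W unit_interval) (subtopology Y ?C) G"
      using G(1) by (auto simp: continuous_map_in_subtopology)
    then show "\<exists>G. continuous_map (prod_topology W unit_interval) (subtopology Y ?C) G \<and>
        (\<forall>w\<in>topspace W. G (w, 0) = g w) \<and>
        (\<forall>w\<in>topspace W. \<forall>t\<in>{0..1}. p (G (w, t)) = F (w, t))"
      using G(2,3) by auto
  qed
  moreover have "unique_path_lifting (subtopology Y ?C) p"
    using upl unfolding unique_path_lifting_def by (simp add: pathin_subtopology)
  moreover have "path_connected_space (subtopology Y ?C)"
    using path_connectedin_path_component_of[of Y y] unfolding path_connectedin_def by simp
  moreover have "y \<in> topspace (subtopology Y ?C)"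
    using y by (simp add: path_component_of_refl)
  ultimately show ?thesis by (simp add: upl_fibration_def)
qed

section \<open>Lifting through the covering of the circle by the line\<close>

lemma cis_2pi_eqD:
  assumes "cis (2 * pi * a) = cis (2 * pi * b)"
  shows "a - b \<in> \<int>"
proof -
  have "cis (2 * pi * (a - b)) = 1"
    using assms by (simp add: right_diff_distrib flip: cis_divide)
  then have "cos (2 * pi * (a - b)) = 1" by (simp add: complex_eq_iff)
  then obtain n :: int where "2 * pi * (a - b) = n * 2 * pi"
    using cos_one_2pi_int by auto
  then show ?thesis by simp
qed

text \<open>The difference of two lifts is continuous and takes integer values, which are at least 1
  apart, so it is constant on the interval.\<close>

lemma cis_lift_unique:
  fixes a b :: "real \<Rightarrow> real"
  assumes "continuous_on {0..1} a" "continuous_on {0..1} b" "a 0 = b 0"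
    and eq: "\<And>t. t \<in> {0..1} \<Longrightarrow> cis (2 * pi * a t) = cis (2 * pi * b t)" and t: "t \<in> {0..1}"
  shows "a t = b t"
proof -
  have int: "a t - b t \<in> \<int>" if "t \<in> {0..1}" for t
    using cis_2pi_eqD[OF eq[OF that]] .
  have "(\<lambda>t. a t - b t) constant_on {0..1}"
  proof (rule continuous_discrete_range_constant)
    fix x :: real assume x: "x \<in> {0..1}"
    have "1 \<le> norm (a y - b y - (a x - b x))"
      if "y \<in> {0..1}" "a y - b y \<noteq> a x - b x" for y
      using Ints_nonzero_abs_ge1[of "a y - b y - (a x - b x)"] int[OF x] int[OF that(1)] that(2)
      by simp
    then show "\<exists>e>0. \<forall>y. y \<in> {0..1} \<and> a y - b y \<noteq> a x - b x \<longrightarrow>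
        e \<le> norm (a y - b y - (a x - b x))"
      by (intro exI[of _ 1]) auto
  qed (use assms in \<open>auto intro: continuous_intros\<close>)
  then have "a t - b t = a 0 - b 0"
    using t unfolding constant_on_def by (metis atLeastAtMost_iff order_refl zero_le_one)
  then show ?thesis using assms(3) by simp
qed

lemma cis_lift_exists:
  assumes "continuous_on {0..1} c" "\<And>t. t \<in> {0..1} \<Longrightarrow> cmod (c t) = 1" "c 0 = cis (2 * pi * a)"
  obtains \<theta> :: "real \<Rightarrow> real"
  where "continuous_on {0..1} \<theta>" "\<theta> 0 = a" "\<And>t. t \<in> {0..1} \<Longrightarrow> cis (2 * pi * \<theta> t) = c t"
proof -
  obtain g where g: "continuous_on {0..1} g" "\<And>t. t \<in> {0..1} \<Longrightarrow> c t = exp (g t)"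
    using continuous_logarithm_on_contractible[of "{0..1}" c] assms
    by (metis convex_imp_contractible convex_real_interval(5) norm_zero zero_neq_one)
  have c: "cis (Im (g t)) = c t" if "t \<in> {0..1}" for t
  proof -
    have "exp (Re (g t)) = 1" using assms(2)[OF that] g(2)[OF that] by simp
    then show ?thesis using g(2)[OF that] by (simp add: exp_eq_polar)
  qed
  \<comment> \<open>The imaginary part of a logarithm of \<open>c\<close> is a lift up to the factor
    \<open>2 * pi\<close>. Replacing its initial value by \<open>a\<close> does not change
    \<open>cis\<close>, because \<open>cis (Im (g 0))\<close> and \<open>cis (2 * pi * a)\<close>
    both equal \<open>c 0\<close>.\<close>
  show ?thesis
  proof (rule that[of "\<lambda>t. (Im (g t) - Im (g 0)) / (2 * pi) + a"])
    fix t :: real assume t: "t \<in> {0..1}"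
    have "cis (2 * pi * ((Im (g t) - Im (g 0)) / (2 * pi) + a)) =
        cis (Im (g t)) / cis (Im (g 0)) * cis (2 * pi * a)"
      by (simp add: cis_divide cis_mult distrib_left)
    then show "cis (2 * pi * ((Im (g t) - Im (g 0)) / (2 * pi) + a)) = c t"
      using c[OF t] c[of 0] assms(2)[of 0] assms(3) by auto
  qed (use g in \<open>auto intro!: continuous_intros\<close>)
qed

text \<open>Since \<open>W\<close> is an arbitrary space, lifts cannot be continued along
  \<open>W\<close>. They are chosen slice by slice over \<open>{w} \<times> [0,1]\<close>, where the
  initial value determines them; continuity in \<open>w\<close> is then a local question, answered
  by compactness of the interval.\<close>

lemma cis_homotopy_lift:
  fixes W :: "'w topology"
  assumes c: "continuous_map (prod_topology W unit_interval) euclidean c"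
    and norm: "\<And>w t. w \<in> topspace W \<Longrightarrow> t \<in> {0..1} \<Longrightarrow> cmod (c (w, t)) = 1"
    and a: "continuous_map W euclideanreal a"
    and c0: "\<And>w. w \<in> topspace W \<Longrightarrow> c (w, 0) = cis (2 * pi * a w)"
  obtains \<theta> where "continuous_map (prod_topology W unit_interval) euclideanreal \<theta>"
    and "\<And>w. w \<in> topspace W \<Longrightarrow> \<theta> (w, 0) = a w"
    and "\<And>w t. w \<in> topspace W \<Longrightarrow> t \<in> {0..1} \<Longrightarrow> cis (2 * pi * \<theta> (w, t)) = c (w, t)"
proof -
  let ?WI = "prod_topology W unit_interval"
  have cw: "continuous_on {0..1} (\<lambda>t. c (w, t))" if "w \<in> topspace W" for w
    using homotopy_pathin[OF c that] by (simp add: pathin_def)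
  have "\<exists>\<theta>. continuous_on {0..1} \<theta> \<and> \<theta> 0 = a w \<and>
          (\<forall>t\<in>{0..1}. cis (2 * pi * \<theta> t) = c (w, t))" if "w \<in> topspace W" for w
    using cis_lift_exists[OF cw[OF that] norm[OF that] c0[OF that]] by metis
  then obtain \<theta> where \<theta>: "\<And>w. w \<in> topspace W \<Longrightarrow> continuous_on {0..1} (\<theta> w)"
    "\<And>w. w \<in> topspace W \<Longrightarrow> \<theta> w 0 = a w"
    "\<And>w t. w \<in> topspace W \<Longrightarrow> t \<in> {0..1} \<Longrightarrow> cis (2 * pi * \<theta> w t) = c (w, t)"
    by metis
  text \<open>Near \<open>w\<^sub>0\<close> the lift differs from the one over \<open>w\<^sub>0\<close> by the principal argument of
    \<open>c (w, t) / c (w\<^sub>0, t)\<close>, which depends continuously on \<open>(w, t)\<close>.\<close>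
  have loc: "\<exists>N. openin W N \<and> w0 \<in> N \<and>
      continuous_map (subtopology ?WI (N \<times> {0..1})) euclideanreal (\<lambda>(w, t). \<theta> w t)"
    if w0: "w0 \<in> topspace W" for w0
  proof -
    define \<rho> where "\<rho> = (\<lambda>(w, t). c (w, t) * cnj (c (w0, t)))"
    have unit: "c (w, t) * cnj (c (w, t)) = 1" if "w \<in> topspace W" "t \<in> {0..1}" for w t
      using norm[OF that] complex_norm_square[of "c (w, t)"] by simp
    have nz: "c (w0, t) \<noteq> 0" if "t \<in> {0..1}" for t using norm[OF w0 that] by auto
    have "continuous_map ?WI euclidean (\<lambda>z. c (w0, snd z))"
      using continuous_map_compose[OF continuous_map_snd, of unit_interval euclidean "\<lambda>t. c (w0, t)" W]
        cw[OF w0] by (simp add: o_def)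
    then have "continuous_map ?WI (prod_topology euclidean euclidean) (\<lambda>z. (c z, c (w0, snd z)))"
      using c by (intro continuous_map_pairedI)
    moreover have "continuous_map euclidean euclidean (\<lambda>z. fst z * cnj (snd z))"
      by (simp add: continuous_intros)
    ultimately have "continuous_map ?WI euclidean ((\<lambda>z. fst z * cnj (snd z)) \<circ> (\<lambda>z. (c z, c (w0, snd z))))"
      by (intro continuous_map_compose) auto
    then have \<rho>: "continuous_map ?WI euclidean \<rho>"
      by (simp add: \<rho>_def o_def case_prod_unfold)
    \<comment> \<open>The quotient equals 1 on the slice over \<open>w0\<close>, so the tube lemma
      gives a neighbourhood of \<open>w0\<close> on which its real part is positive for all times at
      once. There \<open>Arg\<close> stays away from its branch cut.\<close>
    define D where "D = {z \<in> topspace ?WI. \<rho> z \<in> {z. Re z > 0}}"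
    have "openin ?WI D"
      unfolding D_def using \<rho> by (rule openin_continuous_map_preimage)
        (simp add: open_halfspace_Re_gt)
    moreover have "{w0} \<times> {0..1} \<subseteq> D"
      using w0 unit by (auto simp: D_def \<rho>_def)
    ultimately obtain N V where N: "openin W N" "w0 \<in> N" "{0..1} \<subseteq> V" "N \<times> V \<subseteq> D"
      using tube_lemma_right[of W unit_interval D "{0..1}" w0] w0
      by (auto simp: compactin_subtopology)
    have NW: "N \<subseteq> topspace W" using N(1) openin_subset by blast
    let ?S = "subtopology ?WI (N \<times> {0..1})"
    have topS: "topspace ?S = N \<times> {0..1}" using NW by auto
    have Re: "Re (\<rho> (w, t)) > 0" if "w \<in> N" "t \<in> {0..1}" for w t
    proof -
      have "(w, t) \<in> D" using that N(3,4) by blast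
      then show ?thesis by (simp add: D_def)
    qed
    define A where "A = (\<lambda>z. Arg (\<rho> z) / (2 * pi))"
    have "continuous_map ?S (top_of_set {z. Re z > 0}) \<rho>"
      using Re \<rho> topS by (auto simp: continuous_map_in_subtopology continuous_map_from_subtopology)
    moreover have "continuous_on {z. Re z > 0} Arg"
      by (rule continuous_on_subset[OF continuous_on_Arg]) (auto simp: complex_nonpos_Reals_iff)
    ultimately have "continuous_map ?S euclideanreal (Arg \<circ> \<rho>)"
      by (intro continuous_map_compose[of ?S "top_of_set {z. Re z > 0}"]) auto
    then have A: "continuous_map ?S euclideanreal A"
      unfolding A_def o_def by (intro continuous_map_real_divide) auto
    have cisA: "cis (2 * pi * A (w, t)) = \<rho> (w, t)" if "w \<in> N" "t \<in> {0..1}" for w t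
    proof -
      have "cmod (\<rho> (w, t)) = 1"
        using norm[of w t] norm[of w0 t] w0 NW that by (auto simp: \<rho>_def norm_mult)
      moreover have "\<rho> (w, t) \<noteq> 0" using Re[OF that] by auto
      ultimately show ?thesis by (simp add: A_def cis_Arg sgn_eq)
    qed
    \<comment> \<open>The right-hand side is another lift of \<open>c (w, _)\<close>: the quotient
      contributes the factor \<open>c (w, t) / c (w0, t)\<close>. The terms at time 0 only move its
      initial value to \<open>a w\<close>, so uniqueness of lifts applies.\<close>
    have eq: "\<theta> w t = \<theta> w0 t + A (w, t) - A (w, 0) + a w - a w0" if w: "w \<in> N" and t: "t \<in> {0..1}" for w t
    proof (rule cis_lift_unique[OF _ _ _ _ t])
      have wW: "w \<in> topspace W" using w NW by blast
      have "continuous_map unit_interval ?S (\<lambda>t. (w, t))"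
        using w wW by (auto simp: continuous_map_in_subtopology intro!: continuous_map_pairedI)
      from continuous_map_compose[OF this A]
      have "continuous_map unit_interval euclideanreal (\<lambda>t. A (w, t))" by (simp add: o_def)
      then show "continuous_on {0..1} (\<lambda>t. \<theta> w0 t + A (w, t) - A (w, 0) + a w - a w0)"
        using \<theta>(1)[OF w0] by (intro continuous_intros) auto
      show "continuous_on {0..1} (\<theta> w)" "\<theta> w 0 = \<theta> w0 0 + A (w, 0) - A (w, 0) + a w - a w0"
        using \<theta> w0 wW by auto
      fix s :: real assume s: "s \<in> {0..1}"
      have "cis (2 * pi * (\<theta> w0 s + A (w, s) - A (w, 0) + a w - a w0)) =
          cis (2 * pi * \<theta> w0 s) * cis (2 * pi * A (w, s)) / cis (2 * pi * A (w, 0)) *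
          cis (2 * pi * a w) / cis (2 * pi * a w0)"
        by (simp add: cis_mult cis_divide algebra_simps)
      also have "\<dots> = c (w0, s) * \<rho> (w, s) / \<rho> (w, 0) * c (w, 0) / c (w0, 0)"
        using s w wW w0 cisA \<theta>(3) c0 by simp
      also have "\<dots> = c (w, s)"
      proof -
        have inv: "cnj (c (w0, r)) = 1 / c (w0, r)" if "r \<in> {0..1}" for r
          using unit[OF w0 that] nz[OF that] by (simp add: field_simps)
        have "c (w, 0) \<noteq> 0" using norm[OF wW, of 0] by auto
        then show ?thesis
          using nz[OF s] nz[of 0] inv[OF s] inv[of 0] by (simp add: \<rho>_def)
      qed
      also have "\<dots> = cis (2 * pi * \<theta> w s)" using \<theta>(3)[OF wW s] by simp
      finally show "cis (2 * pi * \<theta> w s) =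
          cis (2 * pi * (\<theta> w0 s + A (w, s) - A (w, 0) + a w - a w0))" ..
    qed
    have fst': "continuous_map ?S W fst" and snd': "continuous_map ?S unit_interval snd"
      by (auto intro: continuous_map_from_subtopology continuous_map_fst continuous_map_snd)
    have "continuous_map ?S ?WI (\<lambda>z. (fst z, 0))"
      using fst' by (intro continuous_map_pairedI) auto
    then have "continuous_map ?S ?S (\<lambda>z. (fst z, 0))"
      by (rule continuous_map_into_subtopology) (auto simp: topS)
    from continuous_map_compose[OF this A]
    have A0: "continuous_map ?S euclideanreal (\<lambda>z. A (fst z, 0))" by (simp add: o_def)
    have "continuous_map ?S euclideanreal (\<theta> w0 \<circ> snd)"
      using snd' \<theta>(1)[OF w0] by (intro continuous_map_compose) auto
    moreover have "continuous_map ?S euclideanreal (a \<circ> fst)"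
      using fst' a by (rule continuous_map_compose)
    ultimately have "continuous_map ?S euclideanreal
        (\<lambda>z. \<theta> w0 (snd z) + A z - A (fst z, 0) + a (fst z) - a w0)"
      using A A0 unfolding o_def by (intro continuous_map_add continuous_map_diff) auto
    then have "continuous_map ?S euclideanreal (\<lambda>(w, t). \<theta> w t)"
      by (rule continuous_map_eq) (use topS eq in auto)
    then show ?thesis using N(1,2) by blast
  qed
  then obtain N where N: "\<And>w. w \<in> topspace W \<Longrightarrow> openin W (N w) \<and> w \<in> N w \<and>
      continuous_map (subtopology ?WI (N w \<times> {0..1})) euclideanreal (\<lambda>(w, t). \<theta> w t)"
    by metis
  have "continuous_map ?WI euclideanreal (\<lambda>(w, t). \<theta> w t)"
  proof (rule pasting_lemma[of "topspace W" ?WI "\<lambda>w. N w \<times> {0..1}" _ "\<lambda>_. \<lambda>(w, t). \<theta> w t"])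
    show "openin ?WI (N w \<times> {0..1})" if "w \<in> topspace W" for w
      using N[OF that] by (auto simp: openin_prod_Times_iff)
  qed (use N in auto)
  then show ?thesis
    using that[of "\<lambda>(w, t). \<theta> w t"] \<theta>(2,3) by simp
qed

section \<open>Pullbacks of the covering of the circle by the line\<close>

text \<open>The map \<open>c\<close> may take any complex values; the fibre over \<open>x\<close> is
  empty when \<open>c x\<close> is off the unit circle.\<close>

definition cis_pullback :: "'x topology \<Rightarrow> ('x \<Rightarrow> complex) \<Rightarrow> ('x \<times> real) topology" where
  "cis_pullback X c =
     subtopology (prod_topology X euclideanreal) {(x, r). c x = cis (2 * pi * r)}"

lemma topspace_cis_pullback:
  "topspace (cis_pullback X c) = {(x, r). x \<in> topspace X \<and> c x = cis (2 * pi * r)}"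
  by (auto simp: cis_pullback_def)

lemma continuous_map_into_cis_pullback:
  "continuous_map W (cis_pullback X c) g \<longleftrightarrow>
     continuous_map W X (fst \<circ> g) \<and> continuous_map W euclideanreal (snd \<circ> g) \<and>
     (\<forall>w\<in>topspace W. c (fst (g w)) = cis (2 * pi * snd (g w)))"
  by (auto simp: cis_pullback_def continuous_map_in_subtopology continuous_map_pairwise
      image_subset_iff case_prod_unfold)

lemma continuous_map_fst_cis_pullback: "continuous_map (cis_pullback X c) X fst"
  using continuous_map_into_cis_pullback[of "cis_pullback X c" X c id] by simp

text \<open>The first coordinate of a lift of \<open>F\<close> is forced to be \<open>F\<close>
  itself, so only a real lift of \<open>c \<circ> F\<close> starting at the second coordinate of
  \<open>g\<close> has to be found.\<close>

lemma hurewicz_fibration_cis_pullback: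
  assumes c: "continuous_map X euclidean c"
    and norm: "\<And>x. x \<in> topspace X \<Longrightarrow> cmod (c x) = 1"
  shows "hurewicz_fibration (cis_pullback X c) X fst"
  unfolding hurewicz_fibration_def
proof (intro conjI allI impI continuous_map_fst_cis_pullback; elim conjE)
  fix W :: "(('a \<times> real) \<times> (real \<Rightarrow> 'a)) topology" and g F
  assume g: "continuous_map W (cis_pullback X c) g"
    and F: "continuous_map (prod_topology W unit_interval) X F"
    and eq: "\<forall>w\<in>topspace W. F (w, 0) = fst (g w)"
  have FX: "F (w, t) \<in> topspace X" if "w \<in> topspace W" "t \<in> {0..1}" for w t
    using F that by (auto simp: continuous_map_def Pi_iff)
  have "continuous_map (prod_topology W unit_interval) euclidean (c \<circ> F)"
    using F c by (rule continuous_map_compose)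
  then obtain \<theta> where
    \<theta>: "continuous_map (prod_topology W unit_interval) euclideanreal \<theta>"
    "\<And>w. w \<in> topspace W \<Longrightarrow> \<theta> (w, 0) = (snd \<circ> g) w"
    "\<And>w t. w \<in> topspace W \<Longrightarrow> t \<in> {0..1} \<Longrightarrow> cis (2 * pi * \<theta> (w, t)) = (c \<circ> F) (w, t)"
    by (rule cis_homotopy_lift[where a = "snd \<circ> g"]) (use FX norm eq g in \<open>auto simp: continuous_map_into_cis_pullback\<close>)
  show "\<exists>G. continuous_map (prod_topology W unit_interval) (cis_pullback X c) G \<and>
      (\<forall>w\<in>topspace W. G (w, 0) = g w) \<and>
      (\<forall>w\<in>topspace W. \<forall>t\<in>{0..1}. fst (G (w, t)) = F (w, t))"
  proof (intro exI[of _ "\<lambda>z. (F z, \<theta> z)"] conjI ballI)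
    show "continuous_map (prod_topology W unit_interval) (cis_pullback X c) (\<lambda>z. (F z, \<theta> z))"
      using F \<theta>(1,3) by (auto simp: continuous_map_into_cis_pullback o_def)
  qed (use eq \<theta>(2) in \<open>auto simp: prod_eq_iff\<close>)
qed

lemma unique_path_lifting_cis_pullback: "unique_path_lifting (cis_pullback X c) fst"
  unfolding unique_path_lifting_def
proof (intro allI impI ballI; elim conjE)
  fix \<omega> \<omega>' and t :: real
  assume \<omega>: "pathin (cis_pullback X c) \<omega>" "pathin (cis_pullback X c) \<omega>'" "\<omega> 0 = \<omega>' 0"
    and eq: "\<forall>t\<in>{0..1}. fst (\<omega> t) = fst (\<omega>' t)" and t: "t \<in> {0..1}"
  have "snd (\<omega> t) = snd (\<omega>' t)"
  proof (rule cis_lift_unique[OF _ _ _ _ t])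
    fix s :: real assume "s \<in> {0..1}"
    then have "c (fst (\<omega> s)) = cis (2 * pi * snd (\<omega> s))" "c (fst (\<omega>' s)) = cis (2 * pi * snd (\<omega>' s))"
      using \<omega> by (auto simp: pathin_def continuous_map_into_cis_pullback)
    then show "cis (2 * pi * snd (\<omega> s)) = cis (2 * pi * snd (\<omega>' s))"
      using eq \<open>s \<in> {0..1}\<close> by metis
  qed (use \<omega> in \<open>auto simp: pathin_def continuous_map_into_cis_pullback o_def\<close>)
  then show "\<omega> t = \<omega>' t" using eq t by (auto simp: prod_eq_iff)
qed

section \<open>The winding map on the earring\<close>

text \<open>The circle through \<open>z \<noteq> 0\<close> centred on the axis and touching the origin is \<open>C\<^sub>m\<close> for the
  value \<open>m\<close> below; at the origin \<open>m = 0\<close> by division by zero, and \<open>1\<close> is the right value there.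
  For an integer \<open>\<kappa>\<close> this is the retraction of the earring onto \<open>C\<^sub>\<kappa>\<close>, read in the unit circle;
  the tent function makes it continuous in both arguments.\<close>

definition earring_winding :: "real \<Rightarrow> real \<times> real \<Rightarrow> complex" where
  "earring_winding \<kappa> z = (let m = 2 * fst z / ((fst z)\<^sup>2 + (snd z)\<^sup>2) in
     1 + of_real (m * max 0 (1 - \<bar>m - \<kappa>\<bar>)) * Complex (- fst z) (snd z))"

text \<open>This is the equation of C_m with the squared radius cancelled. Solved for
  \<open>m\<close>, away from the origin, it is the quotient used in
  \<open>earring_winding\<close>.\<close>

lemma earring_loop_power2_sum:
  assumes "m \<ge> 1"
  shows "(fst (earring_loop m t))\<^sup>2 + (snd (earring_loop m t))\<^sup>2 = 2 * fst (earring_loop m t) / real m"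
proof -
  have "(1 - cos (2 * pi * t))\<^sup>2 + (sin (2 * pi * t))\<^sup>2 = 2 * (1 - cos (2 * pi * t))"
    using sin_cos_squared_add[of "2 * pi * t"] by (simp add: power2_diff)
  then have "(1 / real m * (1 - cos (2 * pi * t)))\<^sup>2 + (1 / real m * sin (2 * pi * t))\<^sup>2 =
             (1 / real m)\<^sup>2 * (2 * (1 - cos (2 * pi * t)))"
    by (simp only: power_mult_distrib flip: distrib_left)
  then show ?thesis by (simp add: earring_loop_def power2_eq_square)
qed

lemma earring_loop_in_circle:
  assumes "m \<ge> 1"
  shows "earring_loop m t \<in> earring_circle m"
proof -
  obtain a b where z: "earring_loop m t = (a, b)" by force
  have "(1 / real m - a)\<^sup>2 + b\<^sup>2 = (1 / real m)\<^sup>2"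
    using earring_loop_power2_sum[OF assms, of t] by (simp add: z power2_diff)
  then show ?thesis
    by (simp add: z earring_circle_def dist_prod_def dist_real_def)
qed

lemma topspace_hawaiian_earring: "topspace hawaiian_earring = {earring_loop m t | m t. m \<ge> 1 \<and> t \<in> {0..1}}"
  using earring_circle_loop earring_loop_in_circle by (fastforce simp: hawaiian_earring_def)

lemma earring_loop_0: "earring_loop m 0 = 0" and earring_loop_1: "earring_loop m 1 = 0"
  by (simp_all add: earring_loop_def zero_prod_def)

text \<open>The reflected loop scaled by \<open>m\<close> is \<open>cis (2 * pi * t) - 1\<close>, so
  the value divides the segment from 1 to \<open>cis (2 * pi * t)\<close> in the ratio given by the
  tent. The tent depends only on \<open>m - \<kappa>\<close>: raising both by one, as the gluing
  does, changes nothing.\<close>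

lemma earring_winding_loop:
  assumes "m \<ge> 1"
  shows "earring_winding \<kappa> (earring_loop m t) =
    1 + of_real (max 0 (1 - \<bar>real m - \<kappa>\<bar>)) * (cis (2 * pi * t) - 1)"
proof -
  have C: "of_real (real m) * Complex (- fst (earring_loop m t)) (snd (earring_loop m t)) = cis (2 * pi * t) - 1"
    using assms by (simp add: complex_eq_iff earring_loop_def)
  show ?thesis
  proof (cases "fst (earring_loop m t) = 0")
    case True
    with earring_loop_power2_sum[OF assms, of t] have "snd (earring_loop m t) = 0" by simp
    with C True have "cis (2 * pi * t) - 1 = 0" by (simp add: complex_eq_iff)
    with True show ?thesis by (simp add: earring_winding_def)
  next
    case False
    then have "2 * fst (earring_loop m t) /
        ((fst (earring_loop m t))\<^sup>2 + (snd (earring_loop m t))\<^sup>2) = real m"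
      using assms unfolding earring_loop_power2_sum[OF assms] by simp
    then show ?thesis using C by (simp add: earring_winding_def Let_def mult_ac)
  qed
qed

text \<open>At integer distance the tent is 0 or 1, so the value is an end of the segment: 1 or
  \<open>cis (2 * pi * t)\<close>. For other \<open>\<kappa>\<close> the value can leave the circle,
  for instance be 0 at \<open>\<kappa> = m + 1/2\<close> and \<open>t = 1/2\<close>.\<close>

lemma norm_earring_winding:
  assumes "z \<in> topspace hawaiian_earring" "\<kappa> \<in> \<int>"
  shows "cmod (earring_winding \<kappa> z) = 1"
proof -
  obtain m t where z: "z = earring_loop m t" "m \<ge> 1"
    using assms(1) by (auto simp: topspace_hawaiian_earring)
  have "real m - \<kappa> \<in> \<int>" using assms(2) by simp
  then have "real m = \<kappa> \<or> 1 \<le> \<bar>real m - \<kappa>\<bar>" using Ints_nonzero_abs_ge1[of "real m - \<kappa>"] by auto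
  then show ?thesis using z by (auto simp: earring_winding_loop)
qed

text \<open>Only points with \<open>z = 0\<close> are critical, since \<open>m\<close> is unbounded
  near the origin. Where the tent is nonzero, \<open>m\<close> is within 1 of
  \<open>\<kappa>\<close>, so the distance of the value from 1 is at most
  \<open>(\<bar>\<kappa>\<bar> + 1) * norm z\<close>.\<close>

lemma continuous_on_earring_winding: "continuous_on UNIV (\<lambda>(\<kappa>, z). earring_winding \<kappa> z)"
  unfolding continuous_on_eq_continuous_at[OF open_UNIV]
proof (intro ballI)
  fix x :: "real \<times> real \<times> real"
  obtain \<kappa>0 z0 where x: "x = (\<kappa>0, z0)" by (metis prod.collapse)
  let ?w = "\<lambda>(\<kappa>, z). earring_winding \<kappa> z"
  show "isCont ?w x"
  proof (cases "z0 = 0")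
    case True
    have bound: "norm (?w y - 1) \<le> (\<bar>fst y\<bar> + 1) * norm (snd y)" for y
    proof -
      obtain \<kappa> a b where y: "y = (\<kappa>, a, b)" by (metis prod.collapse)
      define m where "m = 2 * a / (a\<^sup>2 + b\<^sup>2)"
      have le: "\<bar>m * max 0 (1 - \<bar>m - \<kappa>\<bar>)\<bar> \<le> \<bar>\<kappa>\<bar> + 1"
      proof (cases "\<bar>m - \<kappa>\<bar> < 1")
        case True
        then have "\<bar>m * max 0 (1 - \<bar>m - \<kappa>\<bar>)\<bar> \<le> \<bar>m\<bar> * 1"
          unfolding abs_mult by (intro mult_left_mono) auto
        with True show ?thesis by linarith
      qed simp
      have "cmod (Complex (- a) b) = norm (a, b)"
        by (simp add: cmod_def norm_Pair)
      moreover have "?w y - 1 = of_real (m * max 0 (1 - \<bar>m - \<kappa>\<bar>)) * Complex (- a) b"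
        by (simp add: y earring_winding_def Let_def m_def)
      ultimately have "norm (?w y - 1) = \<bar>m * max 0 (1 - \<bar>m - \<kappa>\<bar>)\<bar> * norm (a, b)"
        by (simp only: norm_mult norm_of_real)
      also have "\<dots> \<le> (\<bar>\<kappa>\<bar> + 1) * norm (a, b)"
        using le by (rule mult_right_mono) simp
      finally show ?thesis by (simp add: y)
    qed
    have "((\<lambda>y. (\<bar>fst y\<bar> + 1) * norm (snd y)) \<longlongrightarrow> (\<bar>fst x\<bar> + 1) * norm (snd x)) (at x)"
      by (intro tendsto_intros)
    then have "((\<lambda>y. (\<bar>fst y\<bar> + 1) * norm (snd y)) \<longlongrightarrow> 0) (at x)"
      by (simp add: x True)
    moreover have "\<forall>\<^sub>F y in at x. norm (?w y - 1) \<le> (\<bar>fst y\<bar> + 1) * norm (snd y)"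
      by (intro always_eventually allI bound)
    ultimately have "((\<lambda>y. ?w y - 1) \<longlongrightarrow> 0) (at x)"
      by (rule Lim_null_comparison[rotated])
    then have "(?w \<longlongrightarrow> 1) (at x)" by (simp add: LIM_zero_iff)
    moreover have "?w x = 1" using x True by (simp add: earring_winding_def)
    ultimately show ?thesis by (simp add: isCont_def)
  next
    case False
    then have "(fst (snd x))\<^sup>2 + (snd (snd x))\<^sup>2 \<noteq> 0"
      using x by (simp add: prod_eq_iff sum_power2_eq_zero_iff)
    then show ?thesis
      unfolding earring_winding_def Let_def case_prod_unfold Complex_eq
      by (intro continuous_intros) auto
  qed
qed

section \<open>Maps out of the mapping torus, and its loops\<close>

text \<open>Invariance under a single gluing passes along chains of gluings by induction. This is
  the criterion by which functions on the cylinder descend to the torus.\<close>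

lemma mapping_torus_proj_eqD:
  assumes "mapping_torus_proj X f a = mapping_torus_proj X f b"
    and "a \<in> topspace (prod_topology X unit_interval)" "b \<in> topspace (prod_topology X unit_interval)"
    and \<Phi>: "\<And>x. x \<in> topspace X \<Longrightarrow> \<Phi> (x, 1) = \<Phi> (f x, 0)"
  shows "\<Phi> a = \<Phi> b"
proof -
  have "(symclp (mapping_torus_glue X f))\<^sup>*\<^sup>* a b"
    using assms(1-3) by (simp only: mapping_torus_proj_eq_iff)
  then show ?thesis
    by (induction rule: rtranclp_induct)
      (auto simp: symclp_def elim!: mapping_torus_glue.cases dest: \<Phi>)
qed

lemma mapping_torus_proj_glue:
  assumes "continuous_map X X f" "x \<in> topspace X"
  shows "mapping_torus_proj X f (x, 1) = mapping_torus_proj X f (f x, 0)"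
proof -
  have "f x \<in> topspace X" using assms by (auto simp: continuous_map_def)
  moreover have "symclp (mapping_torus_glue X f) (x, 1) (f x, 0)"
    using assms(2) by (simp add: symclpI1 mapping_torus_glue.intros)
  ultimately show ?thesis
    using assms(2) by (subst mapping_torus_proj_eq_iff) auto
qed

lemma quotient_map_mapping_torus_proj:
  "quotient_map (prod_topology X unit_interval) (mapping_torus X f) (mapping_torus_proj X f)"
  unfolding mapping_torus_def by (rule quotient_map_quotient_topology)

lemma continuous_map_earring_loop:
  assumes "m \<ge> 1"
  shows "continuous_map unit_interval hawaiian_earring (earring_loop m)"
proof -
  have "continuous_on {0..1} (earring_loop m)"
    unfolding earring_loop_def by (intro continuous_intros)
  then show ?thesis
    using earring_loop_in_circle[OF assms] assms by (auto simp: hawaiian_earring_def)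
qed

lemma continuous_map_torus_loop:
  assumes "m \<ge> 1"
  shows "continuous_map (prod_topology unit_interval unit_interval) (mapping_torus hawaiian_earring f)
           (\<lambda>(t, s). mapping_torus_proj hawaiian_earring f (earring_loop m t, s))"
proof -
  have "continuous_map (prod_topology unit_interval unit_interval)
      (prod_topology hawaiian_earring unit_interval) (\<lambda>z. ((earring_loop m \<circ> fst) z, snd z))"
    by (intro continuous_map_pairedI continuous_map_compose[OF continuous_map_fst]
        continuous_map_earring_loop assms continuous_map_snd)
  from continuous_map_compose[OF this quotient_imp_continuous_map[OF quotient_map_mapping_torus_proj]]
  show ?thesis by (simp add: o_def case_prod_unfold)
qed

lemma pathin_torus_loop:
  assumes "m \<ge> 1"
  shows "pathin (mapping_torus hawaiian_earring f)
           (\<lambda>t. mapping_torus_proj hawaiian_earring f (earring_loop m t, 0))"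
proof -
  have "continuous_map unit_interval (prod_topology unit_interval unit_interval) (\<lambda>t. (t, 0))"
    by (intro continuous_map_pairedI) auto
  from continuous_map_compose[OF this continuous_map_torus_loop[OF assms]]
  show ?thesis by (simp add: pathin_def o_def)
qed

section \<open>The fibration in which l_1 does not close up\<close>

text \<open>The second circle-valued map is obtained by restricting a complex map \<open>c\<close>
  on the whole product of the torus with the line, where a quotient map is at hand, to the infinite
  cyclic cover inside it. The tent in \<open>earring_winding\<close> interpolates between the strips
  to make \<open>c\<close> continuous on the product; unit modulus is asserted only on the
  cover.\<close>

lemma torus_upl_fibration_unwinding_loop:
  assumes "is_earring_shift f"
  obtains Z :: "((((real \<times> real) \<times> real) set \<times> real) \<times> real) topology" and r \<eta>
  where "hurewicz_fibration Z (mapping_torus hawaiian_earring f) r" "unique_path_lifting Z r"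
    "pathin Z \<eta>" "\<eta> 0 \<noteq> \<eta> 1"
    "\<And>t. t \<in> {0..1} \<Longrightarrow> r (\<eta> t) = mapping_torus_proj hawaiian_earring f (earring_loop 1 t, 0)"
proof -
  let ?E = hawaiian_earring
  let ?EI = "prod_topology ?E unit_interval"
  let ?T = "mapping_torus ?E f"
  let ?h = "mapping_torus_proj ?E f"
  have h: "quotient_map ?EI ?T ?h" by (rule quotient_map_mapping_torus_proj)
  have hT: "topspace ?T = ?h ` topspace ?EI" using quotient_imp_surjective_map[OF h] by simp
  have fE: "f (earring_loop m t) = earring_loop (Suc m) t" if "m \<ge> 1" "t \<in> {0..1}" for m t
    using assms that by (simp add: is_earring_shift_def)
  have "continuous_map ?EI euclidean ((\<lambda>t. cis (2 * pi * t)) \<circ> snd)"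
    by (rule continuous_map_compose[OF continuous_map_snd]) (auto intro!: continuous_intros)
  then obtain q where q: "continuous_map ?T euclidean q"
    "\<And>x. x \<in> topspace ?EI \<Longrightarrow> q (?h x) = cis (2 * pi * snd x)"
    by (rule quotient_map_lift_exists[OF h])
      (auto dest!: mapping_torus_proj_eqD[where \<Phi> = "\<lambda>x. cis (2 * pi * snd x)"])
  have qnorm: "cmod (q x) = 1" if "x \<in> topspace ?T" for x
    using that q(2) unfolding hT by auto
  \<comment> \<open>The line is locally compact, so multiplying by it preserves the quotient map and
    maps descend from \<open>?EI \<times> \<real>\<close>.\<close>
  have hR: "quotient_map (prod_topology ?EI euclideanreal) (prod_topology ?T euclideanreal)
      (\<lambda>(a, s). (?h a, s))"
    by (rule quotient_map_prod_left[OF _ _ h]) (simp_all add: locally_compact_space_euclidean)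
  text \<open>The strip \<open>\<E> \<times> [k, k + 1]\<close> of the infinite cyclic cover is mapped to the circle by winding
    around \<open>C\<^bsub>k + 1\<^esub>\<close>, and trivially for \<open>k < 0\<close>.\<close>
  define w where "w = (\<lambda>(a, s). earring_winding (s - snd a + 1) (fst a :: real \<times> real))"
  have glue: "w ((x, 1), s) = w ((f x, 0), s)" if "x \<in> topspace ?E" for x s
    using that fE by (auto simp: w_def topspace_hawaiian_earring earring_winding_loop)
  have "continuous_on UNIV (\<lambda>x :: ((real \<times> real) \<times> real) \<times> real. (snd x - snd (fst x) + 1, fst (fst x)))"
    by (intro continuous_intros)
  from continuous_on_compose2[OF continuous_on_earring_winding this subset_UNIV]
  have wc: "continuous_on UNIV w"
    by (simp add: w_def o_def case_prod_unfold)
  have "continuous_map (prod_topology ?EI euclideanreal) euclidean w"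
  proof -
    have "prod_topology ?EI euclideanreal = subtopology euclidean (((\<Union>m\<in>{1..}. earring_circle m) \<times> {0..1}) \<times> UNIV)"
      using prod_topology_subtopology_eu[of _ "UNIV :: real set"]
      by (simp add: hawaiian_earring_def)
    then show ?thesis using wc continuous_on_subset by simp blast
  qed
  then obtain c where c: "continuous_map (prod_topology ?T euclideanreal) euclidean c"
    "\<And>x. x \<in> topspace (prod_topology ?EI euclideanreal) \<Longrightarrow> c ((\<lambda>(a, s). (?h a, s)) x) = w x"
  proof (rule quotient_map_lift_exists[OF hR])
    fix x y assume xy: "x \<in> topspace (prod_topology ?EI euclideanreal)"
      "y \<in> topspace (prod_topology ?EI euclideanreal)"
      "(\<lambda>(a, s). (?h a, s)) x = (\<lambda>(a, s). (?h a, s)) y"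
    obtain a s b where ab: "x = (a, s)" "y = (b, s)" using xy(3) by (cases x, cases y) auto
    have "w (a, s) = w (b, s)"
      using mapping_torus_proj_eqD[of ?E f a b "\<lambda>a. w (a, s)"] xy glue by (auto simp: ab)
    then show "w x = w y" by (simp add: ab)
  qed blast
  have ch: "c (?h a, s) = w (a, s)" if "a \<in> topspace ?EI" for a s
    using c(2)[of "(a, s)"] that by simp
  let ?T1 = "cis_pullback ?T q"
  let ?Z = "cis_pullback ?T1 c"
  have c1: "continuous_map ?T1 euclidean c"
    unfolding cis_pullback_def by (rule continuous_map_from_subtopology[OF c(1)])
  \<comment> \<open>On the cover the line coordinate \<open>s\<close> and the cylinder height
    \<open>t\<close> have the same image in the circle. Hence \<open>s - t + 1\<close>, the index of
    the watched circle, is an integer.\<close>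
  have cnorm: "cmod (c x) = 1" if x: "x \<in> topspace ?T1" for x
  proof -
    obtain a t s where a: "x = (?h (a, t), s)" "a \<in> topspace ?E" "t \<in> {0..1}"
      and qs: "q (?h (a, t)) = cis (2 * pi * s)"
      using x unfolding topspace_cis_pullback hT by auto
    have "cis (2 * pi * t) = cis (2 * pi * s)" using q(2)[of "(a, t)"] a qs by simp
    then have "s - t + 1 \<in> \<int>" using cis_2pi_eqD[of s t] by simp
    then show ?thesis
      using a ch[of "(a, t)" s] norm_earring_winding by (simp add: w_def)
  qed
  have E: "earring_loop 1 t \<in> topspace ?E" if "t \<in> {0..1}" for t
    using that by (auto simp: topspace_hawaiian_earring)
  \<comment> \<open>At line coordinate 0 and height 0 the watched circle is C_1. There
    \<open>c\<close> runs once around the unit circle, with lift \<open>t\<close>, so the ends of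
    the lifted loop differ by 1 in the last coordinate.\<close>
  show thesis
  proof (rule that[of ?Z "fst \<circ> fst" "\<lambda>t. ((?h (earring_loop 1 t, 0), 0), t)"])
    show "hurewicz_fibration ?Z ?T (fst \<circ> fst)"
      by (rule hurewicz_fibration_compose[OF hurewicz_fibration_cis_pullback[OF q(1) qnorm]
            hurewicz_fibration_cis_pullback[OF c1 cnorm]])
    show "unique_path_lifting ?Z (fst \<circ> fst)"
      by (rule unique_path_lifting_compose[OF unique_path_lifting_cis_pullback
            unique_path_lifting_cis_pullback continuous_map_fst_cis_pullback])
    have "continuous_map unit_interval ?T1 (\<lambda>t. (?h (earring_loop 1 t, 0), 0))"
      using pathin_torus_loop[of 1 f] q(2) E
      by (auto simp: continuous_map_into_cis_pullback pathin_def o_def)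
    moreover have "c (?h (earring_loop 1 t, 0), 0) = cis (2 * pi * t)" if "t \<in> {0..1}" for t
      using ch[of "(earring_loop 1 t, 0)" 0] E[OF that] by (simp add: w_def earring_winding_loop)
    ultimately show "pathin ?Z (\<lambda>t. ((?h (earring_loop 1 t, 0), 0), t))"
      by (auto simp: continuous_map_into_cis_pullback pathin_def o_def)
  qed simp_all
qed

section \<open>Closed lifts in coverings\<close>

lemma small_torus_loops:
  assumes "openin (mapping_torus hawaiian_earring f) U"
    and "mapping_torus_proj hawaiian_earring f (0, 0) \<in> U"
  obtains N where "\<And>m t. m \<ge> N \<Longrightarrow> m \<ge> 1 \<Longrightarrow> mapping_torus_proj hawaiian_earring f (earring_loop m t, 0) \<in> U"
proof -
  let ?h = "mapping_torus_proj hawaiian_earring f"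
  let ?EI = "prod_topology hawaiian_earring unit_interval"
  have "openin ?EI {x \<in> topspace ?EI. ?h x \<in> U}"
    using assms(1) by (simp only: mapping_torus_def openin_quotient_topology)
  moreover have "?EI = top_of_set ((\<Union>m\<in>{1..}. earring_circle m) \<times> {0..1})"
    by (simp add: hawaiian_earring_def)
  ultimately obtain S where S: "open S"
    "{x \<in> topspace ?EI. ?h x \<in> U} = ((\<Union>m\<in>{1..}. earring_circle m) \<times> {0..1}) \<inter> S"
    by (auto simp: openin_open)
  have "(0, 0) \<in> {x \<in> topspace ?EI. ?h x \<in> U}"
    using assms(2) earring_loop_0[of 1] by (force simp: topspace_hawaiian_earring)
  then have "(0, 0) \<in> S" using S(2) by blast
  then obtain e where e: "e > 0" "\<And>y. dist y (0, 0) < e \<Longrightarrow> y \<in> S"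
    using S(1) unfolding open_dist by blast
  \<comment> \<open>On C_m the coordinates are bounded by \<open>2 / m\<close> and
    \<open>1 / m\<close>, so the whole loop lies within \<open>3 / m\<close> of the origin.\<close>
  obtain N :: nat where N: "3 / e < real N" using reals_Archimedean2 by blast
  show thesis
  proof (rule that[of N])
    fix m t assume m: "m \<ge> N" "m \<ge> 1"
    have "norm (earring_loop m t) \<le> \<bar>fst (earring_loop m t)\<bar> + \<bar>snd (earring_loop m t)\<bar>"
      by (metis norm_Pair_le prod.collapse real_norm_def)
    also have "\<dots> \<le> 1 / real m * 2 + 1 / real m * 1"
      unfolding earring_loop_def fst_conv snd_conv abs_mult
      using abs_sin_le_one[of "2 * pi * t"] cos_ge_minus_one[of "2 * pi * t"] cos_le_one[of "2 * pi * t"]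
      by (intro add_mono mult_mono) auto
    also have "\<dots> = 3 / real m" by simp
    also have "\<dots> < e" using N e(1) m by (simp add: field_simps) (smt (verit) mult_left_mono of_nat_mono)
    finally have "(earring_loop m t, 0::real) \<in> S"
      by (intro e(2)) (simp add: dist_norm norm_Pair)
    moreover have "(earring_loop m t, 0::real) \<in> (\<Union>m\<in>{1..}. earring_circle m) \<times> {0..1}"
      using m earring_loop_in_circle by auto
    ultimately show "?h (earring_loop m t, 0) \<in> U" using S(2) by blast
  qed
qed

text \<open>Homotopies are lifted in \<open>X\<close> and pushed to \<open>Y\<close> by
  \<open>\<psi>\<close>, so the homotopy lifting property of the covering itself is not invoked. The
  induction ranges over all lifts of the loop: the far edge of a lifted cylinder begins at a point
  over which there is no control.\<close>

lemma torus_loop_closes_in_covering: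
  assumes f: "is_earring_shift f"
    and P: "covering_projection Y (mapping_torus hawaiian_earring f) P"
    and p: "hurewicz_fibration X (mapping_torus hawaiian_earring f) p"
    and \<psi>: "continuous_map X Y \<psi>" "\<And>x. x \<in> topspace X \<Longrightarrow> P (\<psi> x) = p x"
    and m: "m \<ge> 1"
    and \<gamma>: "pathin X \<gamma>"
      "\<And>t. t \<in> {0..1} \<Longrightarrow> p (\<gamma> t) = mapping_torus_proj hawaiian_earring f (earring_loop m t, 0)"
  shows "\<psi> (\<gamma> 0) = \<psi> (\<gamma> 1)"
proof -
  let ?E = hawaiian_earring
  let ?T = "mapping_torus ?E f"
  let ?h = "mapping_torus_proj ?E f"
  let ?closes = "\<lambda>m. \<forall>\<gamma>. pathin X \<gamma> \<and> (\<forall>t\<in>{0..1}. p (\<gamma> t) = ?h (earring_loop m t, 0)) \<longrightarrow>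
      \<psi> (\<gamma> 0) = \<psi> (\<gamma> 1)"
  have lift: "pathin Y (\<psi> \<circ> \<gamma>)" if "pathin X \<gamma>" for \<gamma>
    using that \<psi>(1) by (rule pathin_compose)
  have inX: "\<gamma> t \<in> topspace X" if "pathin X \<gamma>" "t \<in> {0..1}" for \<gamma> t
    using that by (auto simp: pathin_def continuous_map_def)
  have "?h (earring_loop 1 0, 0) \<in> topspace ?T"
    using pathin_torus_loop[of 1 f] by (force simp: pathin_def continuous_map_def)
  then have "?h (0, 0) \<in> topspace ?T" by (simp add: earring_loop_0)
  then obtain U \<V> where U: "openin ?T U" "?h (0, 0) \<in> U"
    "\<Union>\<V> = {y \<in> topspace Y. P y \<in> U}" "\<And>V. V \<in> \<V> \<Longrightarrow> openin Y V" "pairwise disjnt \<V>"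
    "\<And>V. V \<in> \<V> \<Longrightarrow> inj_on P V"
    by (rule covering_projection_evenly_covered[OF P]) blast
  obtain N where N: "\<And>m t. m \<ge> N \<Longrightarrow> m \<ge> 1 \<Longrightarrow> ?h (earring_loop m t, 0) \<in> U"
    using small_torus_loops[OF U(1,2)] by blast
  \<comment> \<open>By connectedness the image of the lifted loop lies in one sheet. Its two ends
    have the same projection, and \<open>P\<close> is injective on the sheet.\<close>
  have small: "?closes k" if k: "k \<ge> N" "k \<ge> 1" for k
  proof (intro allI impI; elim conjE)
    fix \<gamma> assume \<gamma>: "pathin X \<gamma>" "\<forall>t\<in>{0..1}. p (\<gamma> t) = ?h (earring_loop k t, 0)"
    let ?S = "(\<psi> \<circ> \<gamma>) ` {0..1}"
    have "connectedin Y ?S"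
      using lift[OF \<gamma>(1)] unfolding pathin_def
      by (rule connectedin_continuous_map_image) (simp add: connectedin_subtopology)
    moreover have "?S \<subseteq> \<Union>\<V>"
      unfolding U(3) using inX[OF \<gamma>(1)] \<psi> \<gamma>(2) N[OF k] by (auto simp: continuous_map_def)
    ultimately obtain V where V: "V \<in> \<V>" "?S \<subseteq> V"
      using connectedin_disjoint_open_cover[of Y ?S \<V>] U(4,5) by auto
    have "P (\<psi> (\<gamma> 0)) = P (\<psi> (\<gamma> 1))"
      using inX[OF \<gamma>(1)] \<psi>(2) \<gamma>(2) by (simp add: earring_loop_0 earring_loop_1)
    then show "\<psi> (\<gamma> 0) = \<psi> (\<gamma> 1)"
      using U(6)[OF V(1)] V(2) by (auto simp: inj_on_def image_subset_iff)
  qed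
  text \<open>The cylinder over the loop \<open>\<ell>\<^sub>n\<close> is a free homotopy from it to \<open>\<ell>\<^bsub>n + 1\<^esub>\<close>; the two edges of
    its lift lie over the same path.\<close>
  have step: "?closes n" if IH: "?closes (Suc n)" and n: "n \<ge> 1" for n
  proof (intro allI impI; elim conjE)
    fix \<gamma> assume \<gamma>: "pathin X \<gamma>" "\<forall>t\<in>{0..1}. p (\<gamma> t) = ?h (earring_loop n t, 0)"
    have "continuous_map unit_interval X \<gamma>" using \<gamma>(1) by (simp add: pathin_def)
    then obtain G where G: "continuous_map (prod_topology unit_interval unit_interval) X G"
      "\<And>t. t \<in> topspace unit_interval \<Longrightarrow> G (t, 0) = \<gamma> t"
      "\<And>t s. t \<in> topspace unit_interval \<Longrightarrow> s \<in> {0..1} \<Longrightarrow> p (G (t, s)) =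
         (\<lambda>(t, s). ?h (earring_loop n t, s)) (t, s)"
      by (rule hurewicz_fibration_lift[OF p _ continuous_map_torus_loop[OF n]]) (use \<gamma>(2) in auto)
    \<comment> \<open>The edges are traversed backwards: the induction hypothesis makes their images
      agree at height 1, while unique path lifting needs agreement at time 0.\<close>
    have edge: "pathin X (\<lambda>s. G (t, 1 - s))" if "t \<in> {0..1}" for t
    proof -
      have "continuous_map unit_interval (prod_topology unit_interval unit_interval) (\<lambda>s. (t, 1 - s))"
        using that by (intro continuous_map_pairedI) (auto intro!: continuous_intros)
      from continuous_map_compose[OF this G(1)] show ?thesis by (simp add: pathin_def o_def)
    qed
    have "continuous_map unit_interval (prod_topology unit_interval unit_interval) (\<lambda>t. (t, 1))"
      by (intro continuous_map_pairedI) auto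
    from continuous_map_compose[OF this G(1)] have "pathin X (\<lambda>t. G (t, 1))"
      by (simp add: pathin_def o_def)
    moreover have "p (G (t, 1)) = ?h (earring_loop (Suc n) t, 0)" if t: "t \<in> {0..1}" for t
    proof -
      have "earring_loop n t \<in> topspace ?E" using n t by (auto simp: topspace_hawaiian_earring)
      then show ?thesis
        using G(3)[of t 1] t n f mapping_torus_proj_glue[of ?E f]
        by (simp add: is_earring_shift_def)
    qed
    ultimately have meet: "\<psi> (G (0, 1)) = \<psi> (G (1, 1))"
      using IH by (elim allE[of _ "\<lambda>t. G (t, 1)"]) simp
    have e0: "pathin X (\<lambda>s. G (0, 1 - s))" and e1: "pathin X (\<lambda>s. G (1, 1 - s))"
      by (simp_all add: edge)
    have "P (\<psi> (G (0, 1 - s))) = P (\<psi> (G (1, 1 - s)))" if s: "s \<in> {0..1}" for s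
      using inX[OF e0 s] inX[OF e1 s] s G(3)[of 0 "1 - s"] G(3)[of 1 "1 - s"]
      by (simp add: \<psi>(2) earring_loop_0 earring_loop_1)
    with meet have "(\<psi> \<circ> (\<lambda>s. G (0, 1 - s))) t = (\<psi> \<circ> (\<lambda>s. G (1, 1 - s))) t" if "t \<in> {0..1}" for t
      by (intro unique_path_liftingD[OF covering_projection_unique_path_lifting[OF P]
            lift[OF e0] lift[OF e1] _ _ that]) simp_all
    from this[of 1] have "\<psi> (G (0, 0)) = \<psi> (G (1, 0))" by simp
    then show "\<psi> (\<gamma> 0) = \<psi> (\<gamma> 1)" using G(2) by simp
  qed
  have "?closes m"
  \<comment> \<open>The induction descends from an index at least \<open>N\<close>, where the loops
    are small, down to \<open>m\<close>.\<close>
  proof (rule inc_induct[of m "max m N" ?closes])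
    show "?closes (max m N)" by (rule small) (use m in auto)
    show "?closes n" if "?closes (Suc n)" "m \<le> n" for n
      using that(1) by (rule step) (use that(2) m in linarith)
  qed simp
  then show ?thesis using \<gamma> by blast
qed

theorem corollary4p5:
  fixes f :: "real \<times> real \<Rightarrow> real \<times> real"
    and \<T> :: "((real \<times> real) \<times> real) set topology"
    and base :: "((real \<times> real) \<times> real) set"
    and \<T>' :: "'a topology" and base' :: 'a and p :: "'a \<Rightarrow> ((real \<times> real) \<times> real) set"
    and \<Lambda> :: "'i set" and le :: "'i \<Rightarrow> 'i \<Rightarrow> bool"
    and Y :: "'i \<Rightarrow> 'b topology" and F :: "'i \<Rightarrow> 'i \<Rightarrow> 'b \<Rightarrow> 'b"
    and P :: "'i \<Rightarrow> 'b \<Rightarrow> ((real \<times> real) \<times> real) set"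
    and u :: "('i \<Rightarrow> 'b) \<Rightarrow> ((real \<times> real) \<times> real) set" and Y0 :: "('i \<Rightarrow> 'b) set"
  assumes "is_earring_shift f"
    and "\<T> = mapping_torus hawaiian_earring f"
    and "base = mapping_torus_proj hawaiian_earring f ((0, 0), 0)"
    and "universal_upl_fibration \<T>' base' p \<T> base"
    and "covering_inverse_system \<Lambda> le Y F P \<T>"
    and "\<And>y i. y \<in> topspace (inverse_limit \<Lambda> le Y F) \<Longrightarrow> i \<in> \<Lambda> \<Longrightarrow> u y = P i (y i)"
    and "Y0 \<in> path_components_of (inverse_limit \<Lambda> le Y F)"
  shows "\<not> (\<exists>\<phi>. homeomorphic_map \<T>' (subtopology (inverse_limit \<Lambda> le Y F) Y0) \<phi> \<and>
               (\<forall>e\<in>topspace \<T>'. u (\<phi> e) = p e))"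
proof
  let ?h = "mapping_torus_proj hawaiian_earring f"
  let ?L = "inverse_limit \<Lambda> le Y F"
  assume "\<exists>\<phi>. homeomorphic_map \<T>' (subtopology ?L Y0) \<phi> \<and> (\<forall>e\<in>topspace \<T>'. u (\<phi> e) = p e)"
  then obtain \<phi> where \<phi>: "homeomorphic_map \<T>' (subtopology ?L Y0) \<phi>"
    and u: "\<And>e. e \<in> topspace \<T>' \<Longrightarrow> u (\<phi> e) = p e" by blast
  have fib: "hurewicz_fibration \<T>' \<T> p" and base': "base' \<in> topspace \<T>'" "p base' = base"
    using assms(4) by (auto simp: universal_upl_fibration_def upl_fibration_def)
  have base: "base = ?h (earring_loop 1 0, 0)"
    unfolding assms(3) earring_loop_0 by (simp add: zero_prod_def)
  have "pathin \<T> (\<lambda>t. ?h (earring_loop 1 t, 0))"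
    unfolding assms(2) by (rule pathin_torus_loop) simp
  then obtain \<omega> where \<omega>: "pathin \<T>' \<omega>" "\<omega> 0 = base'"
    "\<And>t. t \<in> {0..1} \<Longrightarrow> p (\<omega> t) = ?h (earring_loop 1 t, 0)"
    by (rule hurewicz_fibration_lift_path[OF fib _ base'(1)]) (use base base'(2) in auto)
  have \<omega>T: "\<omega> t \<in> topspace \<T>'" if "t \<in> {0..1}" for t
    using \<omega>(1) that by (auto simp: pathin_def continuous_map_def)
  have cont\<phi>: "continuous_map \<T>' ?L \<phi>"
    using homeomorphic_imp_continuous_map[OF \<phi>] by (simp add: continuous_map_in_subtopology)
  then have cont\<phi>': "continuous_map \<T>' (product_topology Y \<Lambda>) \<phi>"
    by (simp add: inverse_limit_def continuous_map_in_subtopology)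
  have \<phi>L: "\<phi> e \<in> topspace ?L" if "e \<in> topspace \<T>'" for e
    using cont\<phi> that by (auto simp: continuous_map_def)
  have "\<phi> (\<omega> 0) i = \<phi> (\<omega> 1) i" if i: "i \<in> \<Lambda>" for i
  proof (rule torus_loop_closes_in_covering[where \<psi> = "\<lambda>e. \<phi> e i" and P = "P i" and Y = "Y i"
        and X = \<T>' and p = p and m = 1 and \<gamma> = \<omega> and f = f])
    show "covering_projection (Y i) (mapping_torus hawaiian_earring f) (P i)"
      using assms(2,5) i by (auto simp: covering_inverse_system_def)
    show "continuous_map \<T>' (Y i) (\<lambda>e. \<phi> e i)"
      using cont\<phi>' i by (auto simp: continuous_map_componentwise)
    show "P i (\<phi> e i) = p e" if "e \<in> topspace \<T>'" for e
      using assms(6)[OF \<phi>L[OF that] i] u[OF that] by simp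
  qed (use assms(1,2) fib \<omega> in auto)
  moreover have "\<phi> (\<omega> 0) \<in> (\<Pi>\<^sub>E i\<in>\<Lambda>. topspace (Y i))" "\<phi> (\<omega> 1) \<in> (\<Pi>\<^sub>E i\<in>\<Lambda>. topspace (Y i))"
    using cont\<phi>' \<omega>T by (auto simp: continuous_map_def)
  \<comment> \<open>Points of the limit are extensional families, so closing up in every coordinate
    means closing up in the limit. Injectivity of the homeomorphism then brings this back to the
    universal object.\<close>
  ultimately have "\<phi> (\<omega> 0) = \<phi> (\<omega> 1)" by (intro PiE_ext)
  then have closed: "\<omega> 0 = \<omega> 1"
    using homeomorphic_imp_injective_map[OF \<phi>] \<omega>T by (auto simp: inj_on_def)
  obtain Z :: "((((real \<times> real) \<times> real) set \<times> real) \<times> real) topology" and r \<eta>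
    where Z: "hurewicz_fibration Z \<T> r" "unique_path_lifting Z r" and \<eta>: "pathin Z \<eta>" "\<eta> 0 \<noteq> \<eta> 1"
      "\<And>t. t \<in> {0..1} \<Longrightarrow> r (\<eta> t) = ?h (earring_loop 1 t, 0)"
    using torus_upl_fibration_unwinding_loop[OF assms(1)] unfolding assms(2) by metis
  have "\<eta> 0 \<in> topspace Z" using \<eta>(1) by (auto simp: pathin_def continuous_map_def)
  moreover have "base = r (\<eta> 0)" using \<eta>(3)[of 0] base by simp
  ultimately have "upl_fibration (subtopology Z (path_component_of_set Z (\<eta> 0))) (\<eta> 0) r \<T> base"
    using upl_fibration_path_component[OF Z] by simp
  from universal_upl_fibration_morphism[OF assms(4) this] obtain g
    where g: "continuous_map \<T>' Z g" "g base' = \<eta> 0" "\<And>e. e \<in> topspace \<T>' \<Longrightarrow> r (g e) = p e"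
    by (auto simp: upl_morphism_def continuous_map_in_subtopology)
  \<comment> \<open>Both paths lift l_1 from the same point. As \<open>\<omega>\<close> is closed,
    \<open>\<eta>\<close> would have to be closed as well.\<close>
  have "(g \<circ> \<omega>) 1 = \<eta> 1"
  proof (rule unique_path_liftingD[OF Z(2) pathin_compose[OF \<omega>(1) g(1)] \<eta>(1)])
    show "r ((g \<circ> \<omega>) t) = r (\<eta> t)" if "t \<in> {0..1}" for t
      using \<omega>(3)[OF that] \<eta>(3)[OF that] g(3)[OF \<omega>T[OF that]] by simp
  qed (use g(2) \<omega>(2) in simp_all)
  with closed g(2) \<omega>(2) \<eta>(2) show False by simp
qed

end
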